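(* Let $M$ be a compact boundaryless Riemannian surface, let $f\in\mathrm{Diff}^1(M)$ and let $\Lambda\subset M$ be a compact $f$-invariant set. For $\delta>0$ put $\Lambda_\delta=\bigcap_{n\in\mathbb Z}f^n\big(\Lambda\setminus B_\delta(\mathrm{Crit}(f,\Lambda))\big)$. Suppose there exists $\delta_0>0$ such that $\Lambda_{\delta_0}$ is non-empty. Let $0<\delta_1<\delta_0$ and let $\widetilde E\oplus\widetilde F$ be an extension of the dominated splitting $E\oplus F$ of $\Lambda_{\delta_1}$ to a neighborhood of $\Lambda_{\delta_1}$. Then for any $\varepsilon>0$ (such that $B_\varepsilon(\Lambda_{\delta_1})$ is contained in this neighborhood) there exist a positive integer $N_0$ and a constant $\delta_2>0$ such that the following holds for $x\in\Lambda$. (1) If $f^j(x)\notin B_{\delta_1}(\mathrm{Crit}(f,\Lambda))$ for all $0\le j\le n-1$ with $n\ge N_0$, and $f^n(x)\in B_{\delta_2}(\mathrm{Crit}(f,\Lambda))$, then there is a positive integer $n^*<n$ such that $f^{n^*}(x)\in B_\varepsilon(\Lambda_{\delta_1})$, and there exists $c\in\mathrm{Crit}(f,\Lambda)$ with critical direction $v_c$ such that $\mathrm{slope}\big(G^{n-n^*}(\widetilde F_{f^{n^*}(x)}),v_c\big)<\varepsilon$. (2) If $f^{-j}(x)\notin B_{\delta_1}(\mathrm{Crit}(f,\Lambda))$ for all $0\le j\le n-1$ with $n\ge N_0$, and $f^{-n}(x)\in B_{\delta_2}(\mathrm{Crit}(f,\Lambda))$, then there is a positive integer $n^*<n$ such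 that $f^{-n^*}(x)\in B_\varepsilon(\Lambda_{\delta_1})$, and there exists $c\in\mathrm{Crit}(f,\Lambda)$ with critical direction $v_c$ such that $\mathrm{slope}\big(G^{-(n-n^* )}(\widetilde E_{f^{-n^*}(x)}),v_c\big)<\varepsilon$.
   Context: Projective cocycle: for $x\in M$ and a unit vector $v\in T^1_xM$, put $G(v)=D_xf(v)/\|D_xf(v)\|\in T^1_{f(x)}M$ (also used for the induced action on lines). For $n\in\mathbb Z$, $G^n$ is the $n$-th iterate and $g^n(v)>0$ is the absolute value of the derivative at $v$ of $G^n:T^1_xM\to T^1_{f^n(x)}M$; equivalently $g^n(v)=|\det D_xf^n|/\|D_xf^n(v)\|^2$. Critical points: $x\in\Lambda$ is critical if there is $v\in T^1_xM$ (a critical direction) with $g^n(v)\ge1$ for all $n\in\mathbb Z$; $\mathrm{Crit}(f,\Lambda)$ is the set of critical points in $\Lambda$. $B_r(A)$ denotes the open $r$-neighborhood of $A$. The set $\Lambda_{\delta}$ is compact, invariant and contains no critical points. Dominated splitting over a compact invariant set $K$: a $Df$-invariant splitting $T_KM=E\oplus F$ into one-dimensional subbundles with constants $C>0$, $\lambda\in(0,1)$ such that $\|Df^n_{|E_x}\|\le C\lambda^n\|Df^n_{|F_x}\|$ for all $x\in K$, $n\ge0$. The statement presupposes that $\Lambda_{\delta_1}$ carries such a splitting. It extends to a (continuous) splitting $\widetilde E\oplus\widetilde F$ on a small neighborhood $U$ of $K$ which is invariant in the sense that if $x,f(x)\in U$ then $D_xf(\widetilde E_x)=\widetilde E_{f(x)}$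 and $D_xf(\widetilde F_x)=\widetilde F_{f(x)}$, and is close to $E\oplus F$. $\mathrm{slope}(\cdot,\cdot)$ is the slope (angle) between two directions; directions at nearby points are compared by identifying the tangent spaces through fixed local coordinates. *)

theory Defs
  imports "HOL-Analysis.Analysis"
begin

section \<open>Smooth Riemannian surfaces\<close>

primrec Ck_on :: "nat \<Rightarrow> (real^2) set \<Rightarrow> (real^2 \<Rightarrow> 'b::real_normed_vector) \<Rightarrow> bool" where
  "Ck_on 0 S h \<longleftrightarrow> continuous_on S h"
| "Ck_on (Suc k) S h \<longleftrightarrow>
     (\<exists>h'. (\<forall>p\<in>S. (h has_derivative h' p) (at p)) \<and> (\<forall>u. Ck_on k S (\<lambda>p. h' p u)))"

definition smooth_on :: "(real^2) set \<Rightarrow> (real^2 \<Rightarrow> 'b::real_normed_vector) \<Rightarrow> bool" where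
  "smooth_on S h \<longleftrightarrow> (\<forall>k. Ck_on k S h)"

text \<open>A chart is its domain together with its coordinate map. The points of the surface are all
  the points of the type \<open>'a\<close>.\<close>

type_synonym 'a chart = "'a set \<times> ('a \<Rightarrow> real^2)"

record 'a surface =
  charts :: "'a chart set"
  rmetric :: "'a \<Rightarrow> real^2 \<Rightarrow> real^2 \<Rightarrow> real"

abbreviation cdom :: "'a chart \<Rightarrow> 'a set" where "cdom \<equiv> fst"
abbreviation cmap :: "'a chart \<Rightarrow> 'a \<Rightarrow> real^2" where "cmap \<equiv> snd"
abbreviation cinv :: "'a chart \<Rightarrow> real^2 \<Rightarrow> 'a" where "cinv c \<equiv> inv_into (cdom c) (cmap c)"

text \<open>A tangent vector at \<open>x\<close> is a class of pairs (chart around \<open>x\<close>, vector of the plane). We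
  represent it by its member for one preferred chart \<open>chart_at M x\<close>, so that every tangent space is
  a copy of \<open>real^2\<close>. The preferred chart need not depend continuously on \<open>x\<close>; anything that
  compares different base points therefore goes through \<open>dchart M c\<close>, the differential of the
  coordinate map of a fixed chart \<open>c\<close>. The value \<open>rmetric M x u w\<close> is the Riemannian inner product
  of the tangent vectors \<open>u\<close> and \<open>w\<close> at \<open>x\<close>.\<close>

definition chart_at :: "'a surface \<Rightarrow> 'a \<Rightarrow> 'a chart" where
  "chart_at M x = (SOME c. c \<in> charts M \<and> x \<in> cdom c)"

definition dtrans :: "'a chart \<Rightarrow> 'a chart \<Rightarrow> 'a \<Rightarrow> real^2 \<Rightarrow> real^2" where
  "dtrans c d x = frechet_derivative (cmap d \<circ> cinv c) (at (cmap c x))"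

definition dchart :: "'a surface \<Rightarrow> 'a chart \<Rightarrow> 'a \<Rightarrow> real^2 \<Rightarrow> real^2" where
  "dchart M c x = dtrans (chart_at M x) c x"

definition tnorm :: "'a surface \<Rightarrow> 'a \<Rightarrow> real^2 \<Rightarrow> real" where
  "tnorm M x v = sqrt (rmetric M x v v)"

definition curve_length :: "'a::topological_space surface \<Rightarrow> (real \<Rightarrow> 'a) \<Rightarrow> real \<Rightarrow> bool" where
  "curve_length M \<gamma> L \<longleftrightarrow>
     path \<gamma> \<and>
     (\<exists>S. finite S \<and> (\<forall>c\<in>charts M.
        (cmap c \<circ> \<gamma>) C1_differentiable_on ({t\<in>{0..1}. \<gamma> t \<in> cdom c} - S))) \<and>
     ((\<lambda>t. tnorm M (\<gamma> t) (vector_derivative (cmap (chart_at M (\<gamma> t)) \<circ> \<gamma>) (at t)))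
        has_integral L) {0..1}"

definition riemannian_dist :: "'a::topological_space surface \<Rightarrow> 'a \<Rightarrow> 'a \<Rightarrow> real" where
  "riemannian_dist M x y = Inf {L. \<exists>\<gamma>. pathstart \<gamma> = x \<and> pathfinish \<gamma> = y \<and> curve_length M \<gamma> L}"

text \<open>The metric of the type is the Riemannian distance. The surface may be disconnected: between
  different components, where no curve exists, the value of \<open>dist\<close> is left free (subject to the
  axioms of a metric and to the charts being homeomorphisms). Having no boundary is expressed by the
  charts being onto open subsets of the plane.\<close>

locale riemannian_surface =
  fixes M :: "'a::metric_space surface"
  assumes open_chart: "c \<in> charts M \<Longrightarrow> open (cdom c) \<and> open (cmap c ` cdom c)"
    and homeomorphism_chart:
      "c \<in> charts M \<Longrightarrow> homeomorphism (cdom c) (cmap c ` cdom c) (cmap c) (cinv c)"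
    and charts_cover: "(\<Union>c\<in>charts M. cdom c) = UNIV"
    and smooth_transition:
      "c \<in> charts M \<Longrightarrow> d \<in> charts M \<Longrightarrow>
        smooth_on (cmap c ` (cdom c \<inter> cdom d)) (cmap d \<circ> cinv c)"
    and bilinear_metric: "bilinear (rmetric M x)"
    and symmetric_metric: "rmetric M x u w = rmetric M x w u"
    and positive_metric: "u \<noteq> 0 \<Longrightarrow> rmetric M x u u > 0"
    and smooth_metric:
      "c \<in> charts M \<Longrightarrow>
        smooth_on (cmap c ` cdom c)
          (\<lambda>p. let x = cinv c p
               in rmetric M x (dtrans c (chart_at M x) x u) (dtrans c (chart_at M x) x w))"
    and dist_eq_riemannian_dist:
      "connected_component UNIV x y \<Longrightarrow> dist x y = riemannian_dist M x y"

section \<open>Diffeomorphisms and the projective cocycle\<close>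

definition C1_map :: "'a::topological_space surface \<Rightarrow> ('a \<Rightarrow> 'a) \<Rightarrow> bool" where
  "C1_map M f \<longleftrightarrow> continuous_on UNIV f \<and>
     (\<forall>c\<in>charts M. \<forall>d\<in>charts M.
        Ck_on 1 (cmap c ` {x\<in>cdom c. f x \<in> cdom d}) (cmap d \<circ> f \<circ> cinv c))"

definition C1_diffeo :: "'a::topological_space surface \<Rightarrow> ('a \<Rightarrow> 'a) \<Rightarrow> bool" where
  "C1_diffeo M f \<longleftrightarrow> bij f \<and> C1_map M f \<and> C1_map M (inv f)"

definition tmap :: "'a surface \<Rightarrow> ('a \<Rightarrow> 'a) \<Rightarrow> 'a \<Rightarrow> real^2 \<Rightarrow> real^2" where
  "tmap M f x =
     frechet_derivative (cmap (chart_at M (f x)) \<circ> f \<circ> cinv (chart_at M x))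
       (at (cmap (chart_at M x) x))"

text \<open>Integer iterates of a bijection \<open>h\<close> of the set \<open>S\<close>.\<close>

definition ziter_on :: "'b set \<Rightarrow> ('b \<Rightarrow> 'b) \<Rightarrow> int \<Rightarrow> 'b \<Rightarrow> 'b" where
  "ziter_on S h n = (if n \<ge> 0 then h ^^ nat n else inv_into S h ^^ nat (- n))"

abbreviation ziter :: "('b \<Rightarrow> 'b) \<Rightarrow> int \<Rightarrow> 'b \<Rightarrow> 'b" where
  "ziter \<equiv> ziter_on UNIV"

definition unit_bundle :: "'a surface \<Rightarrow> ('a \<times> (real^2)) set" where
  "unit_bundle M = {(x, v). tnorm M x v = 1}"

definition proj_cocycle :: "'a surface \<Rightarrow> ('a \<Rightarrow> 'a) \<Rightarrow> 'a \<times> (real^2) \<Rightarrow> 'a \<times> (real^2)" where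
  "proj_cocycle M f = (\<lambda>(x, v). (f x, (1 / tnorm M (f x) (tmap M f x v)) *\<^sub>R tmap M f x v))"

definition Gpow :: "'a surface \<Rightarrow> ('a \<Rightarrow> 'a) \<Rightarrow> int \<Rightarrow> 'a \<Rightarrow> real^2 \<Rightarrow> real^2" where
  "Gpow M f n x v = snd (ziter_on (unit_bundle M) (proj_cocycle M f) n (x, v))"

text \<open>Lines of a tangent space are one-dimensional subspaces.\<close>

definition Gpow_line :: "'a surface \<Rightarrow> ('a \<Rightarrow> 'a) \<Rightarrow> int \<Rightarrow> 'a \<Rightarrow> (real^2) set \<Rightarrow> (real^2) set" where
  "Gpow_line M f n x L = span (Gpow M f n x ` {v\<in>L. tnorm M x v = 1})"

text \<open>The absolute value of the derivative at \<open>v\<close> of the circle map \<open>Gpow M f n x\<close>: the speed at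
  \<open>\<theta> = 0\<close> of the image of the arc-length parametrization \<open>\<theta> \<mapsto> cos \<theta> v + sin \<theta> w\<close> of the unit
  circle, where \<open>w\<close> is either of the two unit vectors orthogonal to \<open>v\<close>.\<close>

definition gder :: "'a surface \<Rightarrow> ('a \<Rightarrow> 'a) \<Rightarrow> int \<Rightarrow> 'a \<Rightarrow> real^2 \<Rightarrow> real" where
  "gder M f n x v =
     (let w = (SOME w. tnorm M x w = 1 \<and> rmetric M x v w = 0)
      in tnorm M (ziter f n x)
           (vector_derivative (\<lambda>\<theta>. Gpow M f n x (cos \<theta> *\<^sub>R v + sin \<theta> *\<^sub>R w)) (at 0)))"

section \<open>Critical points\<close>

definition critical_direction :: "'a surface \<Rightarrow> ('a \<Rightarrow> 'a) \<Rightarrow> 'a \<Rightarrow> real^2 \<Rightarrow> bool" where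
  "critical_direction M f x v \<longleftrightarrow> tnorm M x v = 1 \<and> (\<forall>n. gder M f n x v \<ge> 1)"

definition Crit :: "'a surface \<Rightarrow> ('a \<Rightarrow> 'a) \<Rightarrow> 'a set \<Rightarrow> 'a set" where
  "Crit M f \<Lambda> = {x\<in>\<Lambda>. \<exists>v. critical_direction M f x v}"

definition nbhd :: "real \<Rightarrow> 'a::metric_space set \<Rightarrow> 'a set" where
  "nbhd r A = (\<Union>a\<in>A. ball a r)"

definition noncritical_part ::
  "'a::metric_space surface \<Rightarrow> ('a \<Rightarrow> 'a) \<Rightarrow> 'a set \<Rightarrow> real \<Rightarrow> 'a set" where
  "noncritical_part M f \<Lambda> \<delta> = (\<Inter>n. ziter f n ` (\<Lambda> - nbhd \<delta> (Crit M f \<Lambda>)))"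

section \<open>Line fields and dominated splittings\<close>

text \<open>For lines \<open>L\<close> and \<open>L'\<close> the set below is a singleton, so the infimum is the angle in
  \<open>{0..pi/2}\<close> between them.\<close>

definition line_angle :: "(real^2) set \<Rightarrow> (real^2) set \<Rightarrow> real" where
  "line_angle L L' = Inf {arccos (\<bar>u \<bullet> w\<bar> / (norm u * norm w)) |u w. u \<in> L - {0} \<and> w \<in> L' - {0}}"

definition slope ::
  "'a surface \<Rightarrow> 'a chart \<Rightarrow> 'a \<Rightarrow> (real^2) set \<Rightarrow> 'a \<Rightarrow> (real^2) set \<Rightarrow> real" where
  "slope M c x L y L' = line_angle (dchart M c x ` L) (dchart M c y ` L')"

text \<open>\<open>K\<close> is the fixed system of local coordinates. Directions at \<open>x\<close> and \<open>y\<close> are comparable only if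
  some chart of \<open>K\<close> contains both points; all such charts are then required to give the bound.\<close>

definition slope_less ::
  "'a surface \<Rightarrow> 'a chart set \<Rightarrow> 'a \<Rightarrow> (real^2) set \<Rightarrow> 'a \<Rightarrow> (real^2) set \<Rightarrow> real \<Rightarrow> bool" where
  "slope_less M K x L y L' \<epsilon> \<longleftrightarrow>
     (\<exists>c\<in>K. x \<in> cdom c \<and> y \<in> cdom c) \<and>
     (\<forall>c\<in>K. x \<in> cdom c \<longrightarrow> y \<in> cdom c \<longrightarrow> slope M c x L y L' < \<epsilon>)"

definition local_coordinates :: "'a surface \<Rightarrow> 'a chart set \<Rightarrow> bool" where
  "local_coordinates M K \<longleftrightarrow> finite K \<and> K \<subseteq> charts M \<and> (\<Union>c\<in>K. cdom c) = UNIV"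

definition continuous_lines ::
  "'a::topological_space surface \<Rightarrow> 'a set \<Rightarrow> ('a \<Rightarrow> (real^2) set) \<Rightarrow> bool" where
  "continuous_lines M S L \<longleftrightarrow>
     (\<forall>c\<in>charts M. \<forall>y\<in>S \<inter> cdom c.
        ((\<lambda>x. slope M c x (L x) y (L y)) \<longlongrightarrow> 0) (at y within S))"

definition splitting ::
  "'a::topological_space surface \<Rightarrow> 'a set \<Rightarrow> ('a \<Rightarrow> (real^2) set) \<Rightarrow> ('a \<Rightarrow> (real^2) set) \<Rightarrow> bool"
  where
  "splitting M S E F \<longleftrightarrow>
     (\<forall>x\<in>S. subspace (E x) \<and> dim (E x) = 1 \<and> subspace (F x) \<and> dim (F x) = 1 \<and>
        E x \<inter> F x = {0} \<and> {u + w |u w. u \<in> E x \<and> w \<in> F x} = UNIV) \<and>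
     continuous_lines M S E \<and> continuous_lines M S F"

definition norm_restrict :: "'a surface \<Rightarrow> ('a \<Rightarrow> 'a) \<Rightarrow> 'a \<Rightarrow> (real^2) set \<Rightarrow> real" where
  "norm_restrict M f x L = Sup {tnorm M (f x) (tmap M f x v) |v. v \<in> L \<and> tnorm M x v = 1}"

definition dominated_splitting ::
  "'a::topological_space surface \<Rightarrow> ('a \<Rightarrow> 'a) \<Rightarrow> 'a set \<Rightarrow>
    ('a \<Rightarrow> (real^2) set) \<Rightarrow> ('a \<Rightarrow> (real^2) set) \<Rightarrow> bool" where
  "dominated_splitting M f K E F \<longleftrightarrow>
     splitting M K E F \<and>
     (\<forall>x\<in>K. tmap M f x ` E x = E (f x) \<and> tmap M f x ` F x = F (f x)) \<and>
     (\<exists>C q. C > 0 \<and> 0 < q \<and> q < 1 \<and>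
        (\<forall>x\<in>K. \<forall>n. norm_restrict M (f ^^ n) x (E x) \<le> C * q ^ n * norm_restrict M (f ^^ n) x (F x)))"

definition extends_splitting ::
  "'a::topological_space surface \<Rightarrow> ('a \<Rightarrow> 'a) \<Rightarrow> 'a set \<Rightarrow>
    ('a \<Rightarrow> (real^2) set) \<Rightarrow> ('a \<Rightarrow> (real^2) set) \<Rightarrow>
    'a set \<Rightarrow> ('a \<Rightarrow> (real^2) set) \<Rightarrow> ('a \<Rightarrow> (real^2) set) \<Rightarrow> bool" where
  "extends_splitting M f K E F U E' F' \<longleftrightarrow>
     open U \<and> K \<subseteq> U \<and> splitting M U E' F' \<and>
     (\<forall>x\<in>K. E' x = E x \<and> F' x = F x) \<and>
     (\<forall>x\<in>U. f x \<in> U \<longrightarrow> tmap M f x ` E' x = E' (f x) \<and> tmap M f x ` F' x = F' (f x))"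

end

theory Submission
  imports Defs
begin

text \<open>
  Argue by contradiction and compactness. Orbit segments violating the claim end at points that
  accumulate on some \<open>c\<close>, which is critical because the set of critical directions is closed. The
  backward orbit of \<open>c\<close> stays outside \<open>B\<^sub>\<delta>\<^sub>1(Crit)\<close>, so it accumulates on \<open>\<Lambda>\<^sub>\<delta>\<^sub>1\<close> only and
  eventually stays where \<open>E'\<close> and \<open>F'\<close> are defined, invariant and dominated. There a direction
  other than \<open>F'\<close> is contracted by the backward projective cocycle; hence the critical direction
  at \<open>c\<close> is the image of \<open>F'\<close> under \<open>f\<^sup>J\<close> for some fixed \<open>J\<close>, and continuity of \<open>F'\<close> and
  of \<open>Df\<^sup>J\<close> contradicts the choice of the segments. The second claim is the first one for \<open>f\<inverse>\<close>
  with \<open>E'\<close> and \<open>F'\<close> exchanged.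
\<close>

section \<open>Derivatives in charts\<close>

text \<open>Directions other than \<open>F'\<close> are excluded by comparing growth. If A is the
  derivative of an iterate and \<open>v\<close> is critical, then g^n(v) \<ge> 1 bounds |Av|^2 by a
  constant times the area of (Av, Aw), and this area is at most |Av| |Aw|. Hence |Av| \<le> B |Aw|
  for all iterates at once, with B depending only on \<open>v\<close> and \<open>w\<close>. With
  \<open>w\<close> the transported \<open>F'\<close> direction, backward iterates of
  \<open>v\<close> cannot outgrow those of \<open>F'\<close>. Domination, however, makes any nonzero
  \<open>E'\<close> component outgrow \<open>F'\<close> in backward time. Of the domination only one
  inequality is kept, for a single iterate f^N. Its factor 1/4 on the noncritical set leaves room
  for the factor 1/2 that holds eventually along the backward orbit of \<open>c\<close>, and it
  turns into the same inequality for the inverse with the two line fields exchanged. The technical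
  obstacle is that tangent spaces at different points can be compared only through charts, so every
  limit of vectors has to be a limit of coordinates in a chart around the limit point.\<close>

definition local_deriv ::
  "'a chart \<Rightarrow> 'a chart \<Rightarrow> ('a \<Rightarrow> 'a) \<Rightarrow> 'a \<Rightarrow> real^2 \<Rightarrow> real^2" where
  "local_deriv c d f x = frechet_derivative (cmap d \<circ> f \<circ> cinv c) (at (cmap c x))"

text \<open>Chart transitions are derivatives of the identity map, so one chain rule and one
  continuity statement for \<open>local_deriv\<close> cover both them and the derivatives of
  \<open>f\<close>.\<close>

lemma dtrans_eq_local_deriv: "dtrans c d = local_deriv c d id"
  by (simp add: fun_eq_iff dtrans_def local_deriv_def)

lemma tmap_eq_local_deriv: "tmap M f x = local_deriv (chart_at M x) (chart_at M (f x)) f x"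
  by (simp add: tmap_def local_deriv_def)

lemma linear_vec2_expansion:
  fixes h :: "real^2 \<Rightarrow> 'b::real_vector"
  assumes "linear h"
  shows "h u = (\<Sum>i\<in>UNIV. u $ i *\<^sub>R h (axis i 1))"
proof -
  have "h u = h (\<Sum>i\<in>UNIV. u $ i *\<^sub>R axis i 1)"
    by (simp add: basis_expansion scalar_mult_eq_scaleR[symmetric])
  then show ?thesis
    by (simp add: linear_sum[OF assms] linear_scale[OF assms])
qed

lemma spans_plane:
  fixes a b z :: "real^2"
  assumes "a \<noteq> 0" "b \<notin> span {a}"
  shows "\<exists>s t. z = s *\<^sub>R a + t *\<^sub>R b"
proof -
  have ind: "independent {b, a}"
    using assms by (simp add: independent_insert)
  have "a \<noteq> b" using assms(2) span_base by blast
  then have "card {b, a} = 2" by auto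
  moreover have "dim (UNIV :: (real^2) set) = 2" by simp
  ultimately have "span {b, a} = UNIV"
    using ind card_eq_dim[of "{b, a}" UNIV] by auto
  then have "z \<in> span {b, a}" by simp
  then show ?thesis
    by (metis (no_types, lifting) add.commute diff_eq_eq span_breakdown_eq span_singleton rangeE)
qed

context riemannian_surface
begin

lemma chart_at: "chart_at M x \<in> charts M" "x \<in> cdom (chart_at M x)"
proof -
  have "\<exists>c. c \<in> charts M \<and> x \<in> cdom c"
    using charts_cover by blast
  from someI_ex[OF this] show "chart_at M x \<in> charts M" "x \<in> cdom (chart_at M x)"
    by (auto simp: chart_at_def)
qed

lemma cinv_cmap: "c \<in> charts M \<Longrightarrow> x \<in> cdom c \<Longrightarrow> cinv c (cmap c x) = x"
  using homeomorphism_chart[of c] by (auto simp: homeomorphism_def)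

lemma open_chart_image:
  assumes "c \<in> charts M" "open V" "V \<subseteq> cdom c"
  shows "open (cmap c ` V)"
proof -
  have "openin (top_of_set (cmap c ` cdom c)) (cmap c ` V)"
    using homeomorphism_imp_open_map[OF homeomorphism_chart[OF assms(1)]] assms
    by (meson open_openin openin_subset_trans subset_UNIV openin_open_eq open_chart)
  then show ?thesis
    using open_chart[OF assms(1)] openin_open_trans by blast
qed

lemma isCont_cmap: "c \<in> charts M \<Longrightarrow> x \<in> cdom c \<Longrightarrow> isCont (cmap c) x"
  using homeomorphism_chart[of c] open_chart[of c]
  by (auto simp: homeomorphism_def continuous_on_eq_continuous_at)

lemma eventually_in_chart:
  assumes "c \<in> charts M" "x \<in> cdom c" "(X \<longlongrightarrow> x) G"
  shows "\<forall>\<^sub>F k in G. X k \<in> cdom c"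
  using topological_tendstoD[OF assms(3)] open_chart[OF assms(1)] assms(2) by blast

lemma C1_map_id: "C1_map M id"
proof -
  have "Ck_on 1 (cmap c ` {x \<in> cdom c. id x \<in> cdom d}) (cmap d \<circ> id \<circ> cinv c)"
    if "c \<in> charts M" "d \<in> charts M" for c d
  proof -
    have "{x \<in> cdom c. id x \<in> cdom d} = cdom c \<inter> cdom d" by auto
    then show ?thesis
      using smooth_transition[OF that] unfolding smooth_on_def by simp
  qed
  then show ?thesis by (auto simp: C1_map_def)
qed

lemma isCont_C1_map: "C1_map M f \<Longrightarrow> isCont f x"
  by (simp add: C1_map_def continuous_on_eq_continuous_at)

lemma open_local_dom:
  assumes "continuous_on UNIV f" "c \<in> charts M" "d \<in> charts M"
  shows "open (cmap c ` {x \<in> cdom c. f x \<in> cdom d})"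
proof (rule open_chart_image[OF assms(2)])
  have "{x \<in> cdom c. f x \<in> cdom d} = cdom c \<inter> f -` cdom d" by auto
  then show "open {x \<in> cdom c. f x \<in> cdom d}"
    using open_chart assms by (simp add: open_Int open_vimage)
qed auto

lemma local_deriv:
  assumes "C1_map M f" "c \<in> charts M" "d \<in> charts M" "x \<in> cdom c" "f x \<in> cdom d"
  shows "((cmap d \<circ> f \<circ> cinv c) has_derivative local_deriv c d f x) (at (cmap c x))"
proof -
  have "Ck_on 1 (cmap c ` {x \<in> cdom c. f x \<in> cdom d}) (cmap d \<circ> f \<circ> cinv c)"
    using assms by (auto simp: C1_map_def)
  then have "(cmap d \<circ> f \<circ> cinv c) differentiable at (cmap c x)"
    using assms(4,5) unfolding One_nat_def Ck_on.simps differentiable_def by blast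
  then show ?thesis
    by (simp add: local_deriv_def frechet_derivative_works)
qed

lemma linear_local_deriv:
  assumes "C1_map M f" "c \<in> charts M" "d \<in> charts M" "x \<in> cdom c" "f x \<in> cdom d"
  shows "linear (local_deriv c d f x)"
  using local_deriv[OF assms] has_derivative_linear by blast

text \<open>\<open>Ck_on\<close> gives continuity of the derivative only for each fixed vector.
  Expanding along the two axis vectors turns this into joint continuity in base point and
  vector.\<close>

lemma local_deriv_tendsto:
  assumes f: "C1_map M f" and c: "c \<in> charts M" "y \<in> cdom c"
    and d: "d \<in> charts M" "f y \<in> cdom d"
    and X: "(X \<longlongrightarrow> y) G" and u: "(u \<longlongrightarrow> v) G"
  shows "((\<lambda>k. local_deriv c d f (X k) (u k)) \<longlongrightarrow> local_deriv c d f y v) G"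
proof -
  let ?S = "cmap c ` {x \<in> cdom c. f x \<in> cdom d}"
  obtain h where h: "\<And>p. p \<in> ?S \<Longrightarrow> ((cmap d \<circ> f \<circ> cinv c) has_derivative h p) (at p)"
    and cont: "\<And>w. continuous_on ?S (\<lambda>p. h p w)"
    using f c d unfolding C1_map_def One_nat_def Ck_on.simps by blast
  have eq: "local_deriv c d f x = h (cmap c x)" if "x \<in> cdom c" "f x \<in> cdom d" for x
    unfolding local_deriv_def using frechet_derivative_at[OF h[of "cmap c x"]] that by auto
  have ev: "\<forall>\<^sub>F k in G. X k \<in> cdom c \<and> f (X k) \<in> cdom d"
    using eventually_in_chart[OF c X]
      eventually_in_chart[OF d isCont_tendsto_compose[OF isCont_C1_map[OF f] X]]
    by (rule eventually_conj)
  have lin: "linear (h (cmap c x))" if "x \<in> cdom c" "f x \<in> cdom d" for x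
    using has_derivative_linear[OF h[of "cmap c x"]] that by auto
  have "((\<lambda>k. \<Sum>i\<in>UNIV. u k $ i *\<^sub>R h (cmap c (X k)) (axis i 1)) \<longlongrightarrow>
      (\<Sum>i\<in>UNIV. v $ i *\<^sub>R h (cmap c y) (axis i 1))) G"
  proof (intro tendsto_sum tendsto_scaleR tendsto_vec_nth u)
    fix i :: 2
    have "isCont (\<lambda>p. h p (axis i 1)) (cmap c y)"
      using cont open_local_dom[of f c d] f c d
      by (auto simp: continuous_on_eq_continuous_at C1_map_def)
    then show "((\<lambda>k. h (cmap c (X k)) (axis i 1)) \<longlongrightarrow> h (cmap c y) (axis i 1)) G"
      using isCont_tendsto_compose[OF _ isCont_tendsto_compose[OF isCont_cmap[OF c] X]] by auto
  qed
  then have "((\<lambda>k. \<Sum>i\<in>UNIV. u k $ i *\<^sub>R h (cmap c (X k)) (axis i 1)) \<longlongrightarrow>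
      local_deriv c d f y v) G"
    using eq[OF c(2) d(2)] linear_vec2_expansion[OF lin[OF c(2) d(2)], of v] by simp
  moreover have "\<forall>\<^sub>F k in G. (\<Sum>i\<in>UNIV. u k $ i *\<^sub>R h (cmap c (X k)) (axis i 1)) =
      local_deriv c d f (X k) (u k)"
    using ev
  proof eventually_elim
    case (elim k)
    then show ?case
      unfolding eq[OF elim[THEN conjunct1] elim[THEN conjunct2]]
      by (intro linear_vec2_expansion[symmetric] lin) auto
  qed
  ultimately show ?thesis
    by (rule Lim_transform_eventually)
qed

section \<open>Chain rule in charts\<close>

lemma local_rep_comp_has_derivative:
  assumes f: "C1_map M f" and g: "C1_map M g"
    and c: "c \<in> charts M" "x \<in> cdom c" and d: "d \<in> charts M" "g x \<in> cdom d"
    and e: "e \<in> charts M" "f (g x) \<in> cdom e"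
  shows "((cmap e \<circ> (f \<circ> g) \<circ> cinv c) has_derivative
    (local_deriv d e f (g x) \<circ> local_deriv c d g x)) (at (cmap c x))"
proof -
  have gc: "((cmap d \<circ> g \<circ> cinv c) has_derivative local_deriv c d g x) (at (cmap c x))"
    using local_deriv assms by blast
  have "(cmap d \<circ> g \<circ> cinv c) (cmap c x) = cmap d (g x)"
    using c by (simp add: cinv_cmap)
  then have fc: "((cmap e \<circ> f \<circ> cinv d) has_derivative local_deriv d e f (g x))
      (at ((cmap d \<circ> g \<circ> cinv c) (cmap c x)))"
    using local_deriv[OF f d(1) e(1) d(2) e(2)] by simp
  \<comment> \<open>Passing through the middle chart \<open>d\<close> is legitimate only where
    \<open>g\<close> lands in \<open>cdom d\<close>; this set is open, which is enough for a
    derivative.\<close>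
  show ?thesis
  proof (rule has_derivative_transform_within_open[OF diff_chain_at[OF gc fc]])
    show "open (cmap c ` {x \<in> cdom c. g x \<in> cdom d})"
      using open_local_dom g c d by (auto simp: C1_map_def)
    show "cmap c x \<in> cmap c ` {x \<in> cdom c. g x \<in> cdom d}"
      using c d by auto
    show "((cmap e \<circ> f \<circ> cinv d) \<circ> (cmap d \<circ> g \<circ> cinv c)) p = (cmap e \<circ> (f \<circ> g) \<circ> cinv c) p"
      if "p \<in> cmap c ` {x \<in> cdom c. g x \<in> cdom d}" for p
      using that c d by (auto simp: cinv_cmap)
  qed
qed

lemma local_deriv_comp:
  assumes "C1_map M f" "C1_map M g"
    and "c \<in> charts M" "x \<in> cdom c" "d \<in> charts M" "g x \<in> cdom d"
    and "e \<in> charts M" "f (g x) \<in> cdom e"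
  shows "local_deriv c e (f \<circ> g) x = local_deriv d e f (g x) \<circ> local_deriv c d g x"
  unfolding local_deriv_def[of c e]
  using frechet_derivative_at[OF local_rep_comp_has_derivative[OF assms]] by simp

lemma C1_map_comp:
  assumes f: "C1_map M f" and g: "C1_map M g"
  shows "C1_map M (f \<circ> g)"
proof -
  have "Ck_on 1 (cmap c ` {x \<in> cdom c. (f \<circ> g) x \<in> cdom e}) (cmap e \<circ> (f \<circ> g) \<circ> cinv c)"
    (is "Ck_on 1 ?S ?h") if c: "c \<in> charts M" and e: "e \<in> charts M" for c e
  proof -
    let ?h' = "\<lambda>p. local_deriv c e (f \<circ> g) (cinv c p)"
    have "(?h has_derivative ?h' p) (at p)" if p: "p \<in> ?S" for p
    proof -
      obtain x where x: "p = cmap c x" "x \<in> cdom c" "f (g x) \<in> cdom e" using p by auto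
      have "(?h has_derivative
          (local_deriv (chart_at M (g x)) e f (g x) \<circ> local_deriv c (chart_at M (g x)) g x))
          (at (cmap c x))"
        by (intro local_rep_comp_has_derivative f g c e x chart_at)
      then show ?thesis
        using local_deriv_comp[OF f g c x(2) chart_at(1) chart_at(2) e x(3)] x c
        by (simp add: cinv_cmap)
    qed
    moreover have "continuous_on ?S (\<lambda>p. ?h' p u)" for u
      unfolding continuous_on_def
    proof
      fix p assume "p \<in> ?S"
      then obtain x where x: "p = cmap c x" "x \<in> cdom c" "f (g x) \<in> cdom e" by auto
      \<comment> \<open>No single middle chart serves the whole domain, so continuity is checked
        point by point, with \<open>d\<close> chosen around \<open>g x\<close>; the factorization
        through \<open>d\<close> then holds near \<open>p\<close>.\<close>
      define d where "d = chart_at M (g x)"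
      have d: "d \<in> charts M" "g x \<in> cdom d" by (simp_all add: d_def chart_at)
      have cinv: "(cinv c \<longlongrightarrow> x) (at p within ?S)"
      proof -
        have "isCont (cinv c) p"
          using homeomorphism_chart[OF c] open_chart[OF c] x
          by (auto simp: homeomorphism_def continuous_on_eq_continuous_at)
        then have "(cinv c \<longlongrightarrow> cinv c p) (at p within ?S)"
          unfolding isCont_def by (rule tendsto_within_subset) simp
        then show ?thesis using x c by (simp add: cinv_cmap)
      qed
      have gcinv: "((\<lambda>q. g (cinv c q)) \<longlongrightarrow> g x) (at p within ?S)"
        by (rule isCont_tendsto_compose[OF isCont_C1_map[OF g] cinv])
      have "((\<lambda>q. local_deriv d e f (g (cinv c q)) (local_deriv c d g (cinv c q) u)) \<longlongrightarrow>
          local_deriv d e f (g x) (local_deriv c d g x u)) (at p within ?S)"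
        by (intro local_deriv_tendsto f g c d e x cinv gcinv tendsto_const)
      moreover have "\<forall>\<^sub>F q in at p within ?S.
          local_deriv d e f (g (cinv c q)) (local_deriv c d g (cinv c q) u) = ?h' q u"
      proof -
        have "\<forall>\<^sub>F q in at p within ?S. q \<in> ?S \<and> g (cinv c q) \<in> cdom d"
          using eventually_in_chart[OF d gcinv]
          by (intro eventually_conj) (auto simp: eventually_at_filter)
        then show ?thesis
        proof eventually_elim
          case (elim q)
          then obtain z where "q = cmap c z" "z \<in> cdom c" "f (g z) \<in> cdom e" by auto
          then show ?case
            using local_deriv_comp[OF f g c _ d(1) _ e, of z] elim c by (simp add: cinv_cmap)
        qed
      qed
      ultimately show "((\<lambda>p. ?h' p u) \<longlongrightarrow> ?h' p u) (at p within ?S)"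
        using local_deriv_comp[OF f g c x(2) d e x(3)] x c
        by (simp add: cinv_cmap Lim_transform_eventually)
    qed
    ultimately show ?thesis
      unfolding One_nat_def Ck_on.simps by (intro exI[of _ ?h']) blast
  qed
  moreover have "continuous_on UNIV (f \<circ> g)"
    using f g continuous_on_compose2[of UNIV f UNIV g] by (simp add: C1_map_def comp_def)
  ultimately show ?thesis by (auto simp: C1_map_def)
qed

lemma tmap_comp:
  assumes "C1_map M f" "C1_map M g"
  shows "tmap M (f \<circ> g) x = tmap M f (g x) \<circ> tmap M g x"
  unfolding tmap_eq_local_deriv using assms by (simp add: local_deriv_comp chart_at)

lemma linear_tmap: "C1_map M f \<Longrightarrow> linear (tmap M f x)"
  unfolding tmap_eq_local_deriv by (intro linear_local_deriv chart_at)

lemma local_deriv_id: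
  assumes "c \<in> charts M" "x \<in> cdom c"
  shows "local_deriv c c id x = id"
proof -
  have "((cmap c \<circ> id \<circ> cinv c) has_derivative id) (at (cmap c x))"
  proof (rule has_derivative_transform_within_open[OF has_derivative_id])
    show "open (cmap c ` cdom c)" using open_chart assms by blast
  qed (use assms in \<open>auto simp: cinv_cmap\<close>)
  then show ?thesis
    unfolding local_deriv_def using frechet_derivative_at by metis
qed

lemma tmap_id: "tmap M id x = id"
  by (simp add: tmap_eq_local_deriv local_deriv_id chart_at)

lemma dchart_eq: "dchart M c x = local_deriv (chart_at M x) c id x"
  by (simp add: dchart_def dtrans_eq_local_deriv)

lemma linear_dchart: "c \<in> charts M \<Longrightarrow> x \<in> cdom c \<Longrightarrow> linear (dchart M c x)"
  unfolding dchart_eq by (intro linear_local_deriv C1_map_id chart_at) auto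

lemma dchart_dtrans:
  assumes "c \<in> charts M" "x \<in> cdom c"
  shows "dchart M c x (dtrans c (chart_at M x) x u) = u"
    and "dtrans c (chart_at M x) x (dchart M c x u) = u"
  using assms local_deriv_comp[OF C1_map_id C1_map_id, of c x "chart_at M x" c]
    local_deriv_comp[OF C1_map_id C1_map_id, of "chart_at M x" x c "chart_at M x"]
  by (simp_all add: chart_at dchart_eq dtrans_eq_local_deriv local_deriv_id fun_eq_iff
      del: comp_id id_comp) (simp_all add: local_deriv_id chart_at)

lemma dchart_tmap:
  assumes "C1_map M f" "c \<in> charts M" "x \<in> cdom c" "d \<in> charts M" "f x \<in> cdom d"
  shows "dchart M d (f x) (tmap M f x v) = local_deriv c d f x (dchart M c x v)"
proof -
  have "local_deriv (chart_at M x) d (id \<circ> f) x =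
      local_deriv (chart_at M (f x)) d id (f x) \<circ> local_deriv (chart_at M x) (chart_at M (f x)) f x"
    by (rule local_deriv_comp) (use assms in \<open>auto simp: chart_at C1_map_id\<close>)
  moreover have "local_deriv (chart_at M x) d (f \<circ> id) x =
      local_deriv c d f (id x) \<circ> local_deriv (chart_at M x) c id x"
    by (rule local_deriv_comp) (use assms in \<open>auto simp: chart_at C1_map_id\<close>)
  ultimately show ?thesis
    by (simp add: dchart_eq tmap_eq_local_deriv fun_eq_iff)
qed

lemma dchart_change:
  assumes "c \<in> charts M" "x \<in> cdom c" "d \<in> charts M" "x \<in> cdom d"
  shows "dchart M d x v = local_deriv c d id x (dchart M c x v)"
  using dchart_tmap[OF C1_map_id assms(1-3), of v] assms(4) by (simp add: tmap_id)

end

section \<open>Convergence of tangent vectors and lines\<close>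

lemma line_angle_span:
  assumes "a \<noteq> 0" "b \<noteq> 0"
  shows "line_angle (span {a}) (span {b}) = arccos (\<bar>a \<bullet> b\<bar> / (norm a * norm b))"
proof -
  have "{arccos (\<bar>u \<bullet> w\<bar> / (norm u * norm w)) |u w. u \<in> span {a} - {0} \<and> w \<in> span {b} - {0}} =
      {arccos (\<bar>a \<bullet> b\<bar> / (norm a * norm b))}" (is "?S = {?r}")
  proof -
    have "arccos (\<bar>u \<bullet> w\<bar> / (norm u * norm w)) = ?r"
      if uw: "u \<in> span {a} - {0}" "w \<in> span {b} - {0}" for u w
    proof -
      obtain s t where st: "u = s *\<^sub>R a" "w = t *\<^sub>R b" using uw by (auto simp: span_singleton)
      with uw have "s \<noteq> 0" "t \<noteq> 0" by auto
      then show ?thesis by (simp add: st abs_mult)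
    qed
    moreover have "?r \<in> ?S" using assms span_base[of a "{a}"] span_base[of b "{b}"] by blast
    ultimately show ?thesis by blast
  qed
  then show ?thesis by (simp add: line_angle_def)
qed

lemma dim1_span:
  fixes L :: "(real^2) set"
  assumes "subspace L" "dim L = 1" "v \<in> L" "v \<noteq> 0"
  shows "L = span {v}"
proof (rule sym, rule subspace_dim_equal)
  show "span {v} \<subseteq> L" using assms by (simp add: span_minimal)
  show "dim L \<le> dim (span {v})" using assms by (simp add: dim_singleton)
qed (use assms in auto)

lemma dim1_obtain:
  fixes L :: "(real^2) set"
  assumes "subspace L" "dim L = 1"
  obtains v where "v \<in> L" "v \<noteq> 0" "L = span {v}"
proof -
  have "\<not> L \<subseteq> {0}" using assms(2) by (metis dim_eq_0 one_neq_zero)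
  then obtain v where "v \<in> L" "v \<noteq> 0" by auto
  then show ?thesis using that dim1_span assms by blast
qed

lemma arccos_tendsto_1:
  assumes "(f \<longlongrightarrow> (1::real)) G" "\<forall>\<^sub>F x in G. \<bar>f x\<bar> \<le> 1"
  shows "((\<lambda>x. arccos (f x)) \<longlongrightarrow> 0) G"
proof -
  have "((\<lambda>x. arccos (f x)) \<longlongrightarrow> arccos 1) G"
    by (rule continuous_on_tendsto_compose[OF continuous_on_arccos' assms(1)])
       (use assms(2) in \<open>auto elim!: eventually_mono\<close>)
  then show ?thesis by simp
qed

lemma line_angle_tendsto_0:
  assumes "(a \<longlongrightarrow> v) G" "v \<noteq> 0"
  shows "((\<lambda>k. line_angle (span {a k}) (span {v})) \<longlongrightarrow> 0) G"
proof -
  have "((\<lambda>k. \<bar>a k \<bullet> v\<bar> / (norm (a k) * norm v)) \<longlongrightarrow> \<bar>v \<bullet> v\<bar> / (norm v * norm v)) G"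
    using assms by (intro tendsto_intros) auto
  moreover have "\<bar>v \<bullet> v\<bar> / (norm v * norm v) = 1"
    using assms by (simp add: power2_norm_eq_inner flip: power2_eq_square)
  moreover have "\<bar>\<bar>x \<bullet> v\<bar> / (norm x * norm v)\<bar> \<le> 1" for x
    using Cauchy_Schwarz_ineq2[of x v] by (auto simp: divide_le_eq_1)
  ultimately have "((\<lambda>k. arccos (\<bar>a k \<bullet> v\<bar> / (norm (a k) * norm v))) \<longlongrightarrow> 0) G"
    by (intro arccos_tendsto_1) auto
  moreover have "\<forall>\<^sub>F k in G. a k \<noteq> 0"
    using assms tendsto_imp_eventually_ne by blast
  then have "\<forall>\<^sub>F k in G. arccos (\<bar>a k \<bullet> v\<bar> / (norm (a k) * norm v)) =
      line_angle (span {a k}) (span {v})"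
    by eventually_elim (use assms in \<open>simp add: line_angle_span\<close>)
  ultimately show ?thesis by (rule Lim_transform_eventually)
qed

text \<open>A line determines a vector only up to scale. Rescaling to the length of \<open>v\<close>
  and choosing the sign by the inner product gives |u - v|^2 = 2 |v|^2 (1 - cos(angle)), which tends
  to 0.\<close>

lemma tendsto_vector_in_line:
  assumes L: "\<And>k. \<exists>a. a \<noteq> 0 \<and> L k = span {a}" and v: "v \<noteq> 0"
    and lim: "((\<lambda>k. line_angle (L k) (span {v})) \<longlongrightarrow> 0) G"
  obtains u where "\<And>k. u k \<in> L k" "(u \<longlongrightarrow> v) G"
proof -
  obtain a where a: "\<And>k. a k \<noteq> 0" "\<And>k. L k = span {a k}" using L by metis
  define s where "s k = (if a k \<bullet> v \<ge> 0 then norm v / norm (a k) else - norm v / norm (a k))" for k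
  define u where "u k = s k *\<^sub>R a k" for k
  define r where "r k = \<bar>a k \<bullet> v\<bar> / (norm (a k) * norm v)" for k
  have r: "0 \<le> r k" "r k \<le> 1" for k
    using Cauchy_Schwarz_ineq2[of "a k" v] by (auto simp: r_def divide_le_eq_1)
  have "((\<lambda>k. cos (arccos (r k))) \<longlongrightarrow> cos 0) G"
    using isCont_tendsto_compose[OF isCont_cos lim] a v by (simp add: line_angle_span r_def)
  moreover have "cos (arccos (r k)) = r k" for k
    using r[of k] by (intro cos_arccos) auto
  ultimately have "(r \<longlongrightarrow> 1) G" by simp
  then have "((\<lambda>k. sqrt (2 * (norm v)\<^sup>2 * (1 - r k))) \<longlongrightarrow> sqrt (2 * (norm v)\<^sup>2 * (1 - 1))) G"
    by (intro tendsto_intros)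
  moreover have "norm (u k - v) = sqrt (2 * (norm v)\<^sup>2 * (1 - r k))" for k
  proof -
    have nu: "norm (u k) = norm v" using a by (auto simp: u_def s_def)
    have "u k \<bullet> v = (norm v)\<^sup>2 * r k"
      using a[of k] v by (auto simp: u_def s_def r_def power2_eq_square field_simps)
    then have "(norm (u k - v))\<^sup>2 = 2 * (norm v)\<^sup>2 * (1 - r k)"
      using nu by (simp add: power2_norm_eq_inner inner_diff inner_commute algebra_simps)
        (simp flip: power2_norm_eq_inner)
    then show ?thesis by (metis norm_ge_zero real_sqrt_unique)
  qed
  ultimately have "((\<lambda>k. norm (u k - v)) \<longlongrightarrow> 0) G" by simp
  then have "(u \<longlongrightarrow> v) G" using LIM_zero_cancel tendsto_norm_zero_iff by blast
  moreover have "u k \<in> L k" for k by (simp add: a u_def span_base span_mul)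
  ultimately show ?thesis using that by blast
qed

context riemannian_surface
begin

text \<open>Components at \<open>X k\<close> refer to the preferred chart there, which jumps with \<open>k\<close>; the
  vectors can therefore only be compared through a chart around the limit point.\<close>

definition tvec_tendsto ::
  "(nat \<Rightarrow> 'a) \<Rightarrow> (nat \<Rightarrow> real^2) \<Rightarrow> 'a \<Rightarrow> real^2 \<Rightarrow> bool" where
  "tvec_tendsto X V x v \<longleftrightarrow> X \<longlonglongrightarrow> x \<and>
     (\<forall>c\<in>charts M. x \<in> cdom c \<longrightarrow> (\<lambda>k. dchart M c (X k) (V k)) \<longlonglongrightarrow> dchart M c x v)"

lemma tvec_tendstoD:
  assumes "tvec_tendsto X V x v"
  shows "X \<longlonglongrightarrow> x"
    and "c \<in> charts M \<Longrightarrow> x \<in> cdom c \<Longrightarrow> (\<lambda>k. dchart M c (X k) (V k)) \<longlonglongrightarrow> dchart M c x v"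
  using assms by (auto simp: tvec_tendsto_def)

text \<open>One chart around the limit suffices: coordinates in another chart arise from the
  derivative of the transition map, which is jointly continuous in point and vector.\<close>

lemma tvec_tendstoI:
  assumes X: "X \<longlonglongrightarrow> x" and c: "c \<in> charts M" "x \<in> cdom c"
    and V: "(\<lambda>k. dchart M c (X k) (V k)) \<longlonglongrightarrow> dchart M c x v"
  shows "tvec_tendsto X V x v"
  unfolding tvec_tendsto_def
proof (intro conjI X ballI impI)
  fix d assume d: "d \<in> charts M" "x \<in> cdom d"
  have "(\<lambda>k. local_deriv c d id (X k) (dchart M c (X k) (V k))) \<longlonglongrightarrow>
      local_deriv c d id x (dchart M c x v)"
    using local_deriv_tendsto[OF C1_map_id c d(1) _ X V] d(2) by simp
  moreover have "\<forall>\<^sub>F k in sequentially.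
      local_deriv c d id (X k) (dchart M c (X k) (V k)) = dchart M d (X k) (V k)"
    using eventually_in_chart[OF c X] eventually_in_chart[OF d X]
    by eventually_elim (use c d in \<open>simp add: dchart_change[of c _ d]\<close>)
  ultimately have "(\<lambda>k. dchart M d (X k) (V k)) \<longlonglongrightarrow> local_deriv c d id x (dchart M c x v)"
    by (rule Lim_transform_eventually)
  then show "(\<lambda>k. dchart M d (X k) (V k)) \<longlonglongrightarrow> dchart M d x v"
    using c d by (simp add: dchart_change[of c _ d])
qed

lemma tvec_tendsto_tmap:
  assumes f: "C1_map M f" and V: "tvec_tendsto X V x v"
  shows "tvec_tendsto (\<lambda>k. f (X k)) (\<lambda>k. tmap M f (X k) (V k)) (f x) (tmap M f x v)"
proof -
  define c d where "c = chart_at M x" and "d = chart_at M (f x)"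
  have c: "c \<in> charts M" "x \<in> cdom c" and d: "d \<in> charts M" "f x \<in> cdom d"
    by (simp_all add: c_def d_def chart_at)
  have X: "X \<longlonglongrightarrow> x" using tvec_tendstoD[OF V] by blast
  have fX: "(\<lambda>k. f (X k)) \<longlonglongrightarrow> f x"
    by (rule isCont_tendsto_compose[OF isCont_C1_map[OF f] X])
  have "(\<lambda>k. local_deriv c d f (X k) (dchart M c (X k) (V k))) \<longlonglongrightarrow>
      local_deriv c d f x (dchart M c x v)"
    by (rule local_deriv_tendsto[OF f c d X tvec_tendstoD(2)[OF V c]])
  moreover have "\<forall>\<^sub>F k in sequentially. local_deriv c d f (X k) (dchart M c (X k) (V k)) =
      dchart M d (f (X k)) (tmap M f (X k) (V k))"
    using eventually_in_chart[OF c X] eventually_in_chart[OF d fX]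
    by eventually_elim (use f c d in \<open>simp add: dchart_tmap[of f c]\<close>)
  ultimately have "(\<lambda>k. dchart M d (f (X k)) (tmap M f (X k) (V k))) \<longlonglongrightarrow>
      local_deriv c d f x (dchart M c x v)"
    by (rule Lim_transform_eventually)
  then show ?thesis
    using tvec_tendstoI[OF fX d] by (simp add: dchart_tmap[OF f c d])
qed

lemma tvec_tendsto_of_coordinates:
  assumes X: "X \<longlonglongrightarrow> x" and c: "c \<in> charts M" "x \<in> cdom c" and W: "W \<longlonglongrightarrow> w"
  shows "tvec_tendsto X (\<lambda>k. dtrans c (chart_at M (X k)) (X k) (W k)) x
    (dtrans c (chart_at M x) x w)"
proof (rule tvec_tendstoI[OF X c])
  have "\<forall>\<^sub>F k in sequentially.
      W k = dchart M c (X k) (dtrans c (chart_at M (X k)) (X k) (W k))"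
    using eventually_in_chart[OF c X] by eventually_elim (use c in \<open>simp add: dchart_dtrans\<close>)
  with W show "(\<lambda>k. dchart M c (X k) (dtrans c (chart_at M (X k)) (X k) (W k))) \<longlonglongrightarrow>
      dchart M c x (dtrans c (chart_at M x) x w)"
    using c by (simp add: dchart_dtrans) (rule Lim_transform_eventually)
qed

text \<open>Vectors with constant coordinates in one chart around \<open>x\<close> converge. This
  carries test vectors at a limit point back to the approximating points.\<close>

lemma tvec_tendsto_exists:
  assumes "X \<longlonglongrightarrow> x"
  obtains V where "tvec_tendsto X V x v"
proof -
  let ?c = "chart_at M x"
  have "tvec_tendsto X (\<lambda>k. dtrans ?c (chart_at M (X k)) (X k) (dchart M ?c x v)) x
      (dtrans ?c (chart_at M x) x (dchart M ?c x v))"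
    by (intro tvec_tendsto_of_coordinates assms chart_at tendsto_const)
  then show ?thesis using that dchart_dtrans(2)[OF chart_at(1) chart_at(2)] by metis
qed

lemma dtrans_linear: "c \<in> charts M \<Longrightarrow> x \<in> cdom c \<Longrightarrow> linear (dtrans c (chart_at M x) x)"
  unfolding dtrans_eq_local_deriv by (intro linear_local_deriv C1_map_id chart_at) (auto simp: chart_at)

lemma dchart_eq_0_iff: "c \<in> charts M \<Longrightarrow> x \<in> cdom c \<Longrightarrow> dchart M c x v = 0 \<longleftrightarrow> v = 0"
  by (metis dchart_dtrans(2) linear_0 linear_dchart)

lemma dchart_image_span:
  "c \<in> charts M \<Longrightarrow> x \<in> cdom c \<Longrightarrow> dchart M c x ` span {v} = span {dchart M c x v}"
  using linear_span_image[OF linear_dchart, of c x "{v}"] by simp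

lemma rmetric_left: "linear (\<lambda>u. rmetric M x u w)" and rmetric_right: "linear (rmetric M x u)"
  using bilinear_metric[of x] by (auto simp: bilinear_def)

lemmas rmetric_simps =
  linear_add[OF rmetric_left] linear_add[OF rmetric_right]
  linear_diff[OF rmetric_left] linear_diff[OF rmetric_right]
  linear_scale[OF rmetric_left] linear_scale[OF rmetric_right]
  linear_0[OF rmetric_left] linear_0[OF rmetric_right]

text \<open>\<open>smooth_metric\<close> speaks of two fixed coordinate vectors only; bilinearity
  reduces moving arguments to the four metric coefficients in a chart around
  \<open>x\<close>.\<close>

lemma rmetric_tendsto:
  assumes U: "tvec_tendsto X U x u" and W: "tvec_tendsto X W x w"
  shows "(\<lambda>k. rmetric M (X k) (U k) (W k)) \<longlonglongrightarrow> rmetric M x u w"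
proof -
  define c where "c = chart_at M x"
  have c: "c \<in> charts M" "x \<in> cdom c" by (simp_all add: c_def chart_at)
  have X: "X \<longlonglongrightarrow> x" using tvec_tendstoD[OF U] by blast
  let ?D = "\<lambda>y. dtrans c (chart_at M y) y"
  let ?h = "\<lambda>y i j. rmetric M y (?D y (axis i 1)) (?D y (axis j 1))"
  have expand: "rmetric M y u w = (\<Sum>i\<in>UNIV. dchart M c y u $ i *\<^sub>R (\<Sum>j\<in>UNIV.
      dchart M c y w $ j *\<^sub>R ?h y i j))" if y: "y \<in> cdom c" for y u w
  proof -
    have lin: "linear (\<lambda>a. rmetric M y (?D y a) b)" "linear (\<lambda>a. rmetric M y b (?D y a))" for b
      using linear_compose[OF dtrans_linear[OF c(1) y] rmetric_left]
        linear_compose[OF dtrans_linear[OF c(1) y] rmetric_right]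
      by (simp_all add: comp_def)
    have "rmetric M y u w = rmetric M y (?D y (dchart M c y u)) (?D y (dchart M c y w))"
      using c y by (simp add: dchart_dtrans)
    also have "\<dots> = (\<Sum>i\<in>UNIV. dchart M c y u $ i *\<^sub>R
        rmetric M y (?D y (axis i 1)) (?D y (dchart M c y w)))"
      by (rule linear_vec2_expansion[OF lin(1)])
    also have "\<dots> = (\<Sum>i\<in>UNIV. dchart M c y u $ i *\<^sub>R (\<Sum>j\<in>UNIV. dchart M c y w $ j *\<^sub>R ?h y i j))"
      by (intro sum.cong refl arg_cong[where f = "\<lambda>b. _ *\<^sub>R b"] linear_vec2_expansion[OF lin(2)])
    finally show ?thesis .
  qed
  have h: "(\<lambda>k. ?h (X k) i j) \<longlonglongrightarrow> ?h x i j" for i j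
  proof -
    let ?H = "\<lambda>p. let y = cinv c p in ?h y i j"
    have "continuous_on (cmap c ` cdom c) ?H"
      using smooth_metric[OF c(1), of "axis i 1" "axis j 1"] unfolding smooth_on_def
      by (elim allE[of _ 0]) simp
    then have "isCont ?H (cmap c x)"
      using open_chart[OF c(1)] c by (simp add: continuous_on_eq_continuous_at)
    then have "(\<lambda>k. ?H (cmap c (X k))) \<longlonglongrightarrow> ?H (cmap c x)"
      by (rule isCont_tendsto_compose[OF _ isCont_tendsto_compose[OF isCont_cmap[OF c] X]])
    moreover have "\<forall>\<^sub>F k in sequentially. ?H (cmap c (X k)) = ?h (X k) i j"
      using eventually_in_chart[OF c X] by eventually_elim (use c in \<open>simp add: cinv_cmap Let_def\<close>)
    ultimately have "(\<lambda>k. ?h (X k) i j) \<longlonglongrightarrow> ?H (cmap c x)"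
      by (rule Lim_transform_eventually)
    then show ?thesis using c by (simp add: cinv_cmap Let_def)
  qed
  have "(\<lambda>k. \<Sum>i\<in>UNIV. dchart M c (X k) (U k) $ i *\<^sub>R (\<Sum>j\<in>UNIV.
      dchart M c (X k) (W k) $ j *\<^sub>R ?h (X k) i j)) \<longlonglongrightarrow> (\<Sum>i\<in>UNIV. dchart M c x u $ i *\<^sub>R (\<Sum>j\<in>UNIV.
      dchart M c x w $ j *\<^sub>R ?h x i j))"
    by (intro tendsto_sum tendsto_scaleR tendsto_vec_nth h tvec_tendstoD(2)[OF U c]
        tvec_tendstoD(2)[OF W c])
  moreover have "\<forall>\<^sub>F k in sequentially. (\<Sum>i\<in>UNIV. dchart M c (X k) (U k) $ i *\<^sub>R (\<Sum>j\<in>UNIV.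
      dchart M c (X k) (W k) $ j *\<^sub>R ?h (X k) i j)) = rmetric M (X k) (U k) (W k)"
    using eventually_in_chart[OF c X] by eventually_elim (rule expand[symmetric])
  ultimately show ?thesis
    unfolding expand[OF c(2), of u w] by (rule Lim_transform_eventually)
qed

section \<open>Norm, area and compactness of directions\<close>

lemma rmetric_nonneg: "rmetric M x u u \<ge> 0"
  by (metis positive_metric rmetric_simps(7) order_le_less)

lemma tnorm_power2: "(tnorm M x u)\<^sup>2 = rmetric M x u u"
  by (simp add: tnorm_def rmetric_nonneg)

lemma tnorm_nonneg: "tnorm M x u \<ge> 0"
  by (simp add: tnorm_def rmetric_nonneg)

lemma tnorm_eq_0_iff: "tnorm M x u = 0 \<longleftrightarrow> u = 0"
  by (metis order_less_irrefl positive_metric real_sqrt_eq_zero_cancel_iff rmetric_simps(7) tnorm_def)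

lemma tnorm_pos: "u \<noteq> 0 \<Longrightarrow> tnorm M x u > 0"
  using tnorm_nonneg[of x u] tnorm_eq_0_iff[of x u] by linarith

lemma tnorm_scaleR: "tnorm M x (a *\<^sub>R u) = \<bar>a\<bar> * tnorm M x u"
  by (simp add: tnorm_def rmetric_simps real_sqrt_mult flip: mult.assoc)

lemma tnorm_tendsto:
  "tvec_tendsto X U x u \<Longrightarrow> (\<lambda>k. tnorm M (X k) (U k)) \<longlonglongrightarrow> tnorm M x u"
  unfolding tnorm_def by (intro tendsto_real_sqrt rmetric_tendsto)

text \<open>The Gram determinant, that is, the squared area of the parallelogram on \<open>u\<close>
  and \<open>w\<close>. It replaces determinants, since the tangent spaces carry no chosen
  orthonormal bases.\<close>

definition gram :: "'a \<Rightarrow> real^2 \<Rightarrow> real^2 \<Rightarrow> real" where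
  "gram x u w = rmetric M x u u * rmetric M x w w - (rmetric M x u w)\<^sup>2"

lemma gram_combination: "gram x u (s *\<^sub>R u + t *\<^sub>R w) = t\<^sup>2 * gram x u w"
  using symmetric_metric[of x u w]
  by (simp add: gram_def rmetric_simps power2_eq_square algebra_simps)

lemma gram_scaleR_left: "gram x (s *\<^sub>R u) w = s\<^sup>2 * gram x u w"
  by (simp add: gram_def rmetric_simps power2_eq_square algebra_simps)

lemma gram_nonneg: "gram x u w \<ge> 0"
proof (cases "u = 0")
  case False
  define a where "a = rmetric M x u u"
  have a: "a > 0" using False positive_metric by (simp add: a_def)
  \<comment> \<open>\<open>?z\<close> is the component of \<open>w\<close> orthogonal to
    \<open>u\<close>, so the squared area is |u|^2 |z|^2.\<close>
  let ?z = "w - (rmetric M x u w / a) *\<^sub>R u"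
  have "gram x u w = a * rmetric M x ?z ?z"
    using a symmetric_metric[of x u w]
    by (simp add: gram_def rmetric_simps power2_eq_square field_simps flip: a_def)
  then show ?thesis using a rmetric_nonneg by simp
qed (simp add: gram_def rmetric_simps)

lemma rmetric_le: "rmetric M x u w \<le> tnorm M x u * tnorm M x w"
proof -
  have "(rmetric M x u w)\<^sup>2 \<le> (tnorm M x u * tnorm M x w)\<^sup>2"
    using gram_nonneg[of x u w] by (simp add: gram_def power_mult_distrib tnorm_power2)
  then show ?thesis
    using tnorm_nonneg
    by (meson abs_le_D1 abs_le_square_iff abs_of_nonneg mult_nonneg_nonneg power2_le_imp_le)
qed

lemma tnorm_triangle: "tnorm M x (u + w) \<le> tnorm M x u + tnorm M x w"
proof -
  have "(tnorm M x (u + w))\<^sup>2 \<le> (tnorm M x u + tnorm M x w)\<^sup>2"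
    using rmetric_le[of x u w] symmetric_metric[of x u w]
    by (simp add: power2_sum tnorm_power2 rmetric_simps)
  then show ?thesis using tnorm_nonneg by (meson add_nonneg_nonneg power2_le_imp_le)
qed

lemma gram_tendsto:
  "tvec_tendsto X U x u \<Longrightarrow> tvec_tendsto X W x w \<Longrightarrow>
    (\<lambda>k. gram (X k) (U k) (W k)) \<longlonglongrightarrow> gram x u w"
  unfolding gram_def by (intro tendsto_intros rmetric_tendsto)

text \<open>Coordinate vectors normalized in a chart around \<open>x\<close> lie on one fixed
  Euclidean sphere, whose compactness provides the subsequence. The scalars \<open>a k\<close> are
  harmless because criticality depends only on the line.\<close>

lemma nonzero_direction_subseq:
  assumes X: "X \<longlonglongrightarrow> x" and V: "\<And>k. V k \<noteq> 0"
  obtains r a v where "strict_mono r" "\<And>k. a k \<noteq> 0" "v \<noteq> 0"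
    "tvec_tendsto (X \<circ> r) (\<lambda>k. a k *\<^sub>R V (r k)) x v"
proof -
  define c where "c = chart_at M x"
  have c: "c \<in> charts M" "x \<in> cdom c" by (simp_all add: c_def chart_at)
  obtain N where N: "\<And>k. k \<ge> N \<Longrightarrow> X k \<in> cdom c"
    using eventually_in_chart[OF c X] by (auto simp: eventually_sequentially)
  \<comment> \<open>The shift by \<open>N\<close> discards terms outside \<open>cdom c\<close>,
    where \<open>dchart M c\<close> has no meaning.\<close>
  define n where "n k = norm (dchart M c (X (k + N)) (V (k + N)))" for k
  define Y where "Y k = dchart M c (X (k + N)) ((1 / n k) *\<^sub>R V (k + N))" for k
  have n: "n k \<noteq> 0" for k using N[of "k + N"] V c by (simp add: n_def dchart_eq_0_iff)
  have Y: "Y k \<in> sphere 0 1" for k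
    using n[of k] N[of "k + N"] c
    by (simp add: Y_def linear_scale[OF linear_dchart]) (simp add: n_def)
  obtain w s where ws: "w \<in> sphere 0 1" "strict_mono s" "(Y \<circ> s) \<longlonglongrightarrow> w"
    using compact_sphere[of "0 :: real^2" 1] Y unfolding compact_eq_seq_compact_metric seq_compact_def
    by metis
  define v where "v = dtrans c (chart_at M x) x w"
  have v: "dchart M c x v = w" using c by (simp add: v_def dchart_dtrans)
  show ?thesis
  proof (rule that)
    show r: "strict_mono (\<lambda>k. s k + N)" using ws(2) by (auto simp: strict_mono_def)
    show "1 / n (s k) \<noteq> 0" for k using n by simp
    show "v \<noteq> 0" using v ws(1) c linear_0[OF linear_dchart[OF c]] by auto
    show "tvec_tendsto (X \<circ> (\<lambda>k. s k + N)) (\<lambda>k. (1 / n (s k)) *\<^sub>R V (s k + N)) x v"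
    proof (rule tvec_tendstoI[OF LIMSEQ_subseq_LIMSEQ[OF X r] c])
      show "(\<lambda>k. dchart M c ((X \<circ> (\<lambda>k. s k + N)) k) ((1 / n (s k)) *\<^sub>R V (s k + N))) \<longlonglongrightarrow>
          dchart M c x v"
        using ws(3) unfolding v by (simp add: comp_def Y_def)
    qed
  qed
qed

text \<open>Continuity of a line field is given through slopes, whereas the limit arguments need
  vectors. The angle to the limit line is turned into convergent coordinate vectors, which are then
  read back through the chart.\<close>

lemma continuous_lines_lift:
  assumes L: "continuous_lines M S L" and line: "\<And>y. y \<in> S \<Longrightarrow> subspace (L y) \<and> dim (L y) = 1"
    and X: "X \<longlonglongrightarrow> x" "\<And>k. X k \<in> S" "x \<in> S" and v: "v \<in> L x" "v \<noteq> 0"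
  obtains V where "\<And>k. V k \<in> L (X k)" "tvec_tendsto X V x v"
proof -
  define c where "c = chart_at M x"
  have c: "c \<in> charts M" "x \<in> cdom c" by (simp_all add: c_def chart_at)
  have Lx: "L x = span {v}" using dim1_span line X(3) v by blast
  have dv: "dchart M c x v \<noteq> 0" using v c by (simp add: dchart_eq_0_iff)
  let ?h = "\<lambda>y. slope M c y (L y) x (L x)"
  have h: "?h y = line_angle (dchart M c y ` L y) (span {dchart M c x v})" for y
    using c by (simp add: slope_def Lx dchart_image_span)
  \<comment> \<open>The limit defining continuity is punctured at \<open>x\<close>, while the
    sequence \<open>X\<close> may hit \<open>x\<close>; the value 0 there closes the gap.\<close>
  have "?h x = 0"
    unfolding h unfolding Lx using dv c by (simp add: dchart_image_span line_angle_span)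
      (simp flip: power2_eq_square power2_norm_eq_inner)
  then have "continuous (at x within S) ?h"
    using L c X by (simp add: continuous_lines_def continuous_within)
  then have lim: "(\<lambda>k. ?h (X k)) \<longlonglongrightarrow> 0"
    using continuous_within_tendsto_compose'[of x S ?h X sequentially] X \<open>?h x = 0\<close> by simp
  \<comment> \<open>For the finitely many terms outside the chart the limit line is a placeholder,
    so that \<open>Q k\<close> is a line for every \<open>k\<close>.\<close>
  define Q where "Q k = (if X k \<in> cdom c then dchart M c (X k) ` L (X k) else span {dchart M c x v})" for k
  have Q: "\<exists>a. a \<noteq> 0 \<and> Q k = span {a}" for k
  proof (cases "X k \<in> cdom c")
    case True
    obtain a where "a \<noteq> 0" "L (X k) = span {a}" using dim1_obtain line X(2) by metis
    with True c show ?thesis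
      by (intro exI[of _ "dchart M c (X k) a"]) (simp add: Q_def dchart_eq_0_iff dchart_image_span)
  qed (use dv in \<open>auto simp: Q_def\<close>)
  have ev: "\<forall>\<^sub>F k in sequentially. X k \<in> cdom c" by (rule eventually_in_chart[OF c X(1)])
  have "(\<lambda>k. line_angle (Q k) (span {dchart M c x v})) \<longlonglongrightarrow> 0"
    by (rule Lim_transform_eventually[OF lim])
       (use ev in \<open>eventually_elim, simp add: h Q_def\<close>)
  then obtain u where u: "\<And>k. u k \<in> Q k" "u \<longlonglongrightarrow> dchart M c x v"
    using tendsto_vector_in_line[of Q, OF Q dv] by blast
  have "\<exists>w \<in> L (X k). X k \<in> cdom c \<longrightarrow> dchart M c (X k) w = u k" for k
    using u(1)[of k] line[OF X(2)[of k]] subspace_0 by (auto simp: Q_def split: if_splits)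
  then obtain V where V: "\<And>k. V k \<in> L (X k)" "\<And>k. X k \<in> cdom c \<Longrightarrow> dchart M c (X k) (V k) = u k"
    by metis
  have "tvec_tendsto X V x v"
    by (rule tvec_tendstoI[OF X(1) c], rule Lim_transform_eventually[OF u(2)])
       (use ev V in \<open>auto elim: eventually_mono\<close>)
  then show ?thesis using that V by blast
qed

lemma slope_tendsto_0:
  assumes V: "tvec_tendsto X V x v" "v \<noteq> 0" and c: "c \<in> charts M" "x \<in> cdom c"
  shows "(\<lambda>k. slope M c (X k) (span {V k}) x (span {v})) \<longlonglongrightarrow> 0"
proof -
  have "(\<lambda>k. line_angle (span {dchart M c (X k) (V k)}) (span {dchart M c x v})) \<longlonglongrightarrow> 0"
    using tvec_tendstoD(2)[OF V(1) c] V(2) c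
    by (intro line_angle_tendsto_0) (simp_all add: dchart_eq_0_iff)
  then show ?thesis
    by (rule Lim_transform_eventually)
       (use eventually_in_chart[OF c tvec_tendstoD(1)[OF V(1)]] in eventually_elim,
        use c in \<open>simp add: slope_def dchart_image_span\<close>)
qed

end

section \<open>Iterates and critical directions\<close>

lemma ziter_0: "ziter f 0 = id"
  by (simp add: ziter_on_def)

lemma ziter_0_apply: "ziter f 0 x = x"
  by (simp add: ziter_on_def)

lemma ziter_of_nat: "ziter f (int n) = f ^^ n"
  by (simp add: ziter_on_def)

lemma ziter_add_1:
  assumes "bij f"
  shows "ziter f (n + 1) = f \<circ> ziter f n"
proof (cases "n \<ge> 0")
  case True
  then show ?thesis by (simp add: ziter_on_def nat_add_distrib)
next
  case False
  define k where "k = nat (- (n + 1))"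
  have n: "n = - int (Suc k)" using False by (simp add: k_def)
  have "ziter f (n + 1) = inv f ^^ k" by (cases k) (simp_all add: n ziter_on_def nat_add_distrib)
  moreover have "ziter f n = inv f \<circ> inv f ^^ k" by (simp add: n ziter_on_def nat_add_distrib)
  ultimately show ?thesis
    using assms by (simp add: fun_eq_iff bij_is_surj surj_f_inv_f)
qed

lemma ziter_minus_1:
  assumes "bij f"
  shows "ziter f (n - 1) = inv f \<circ> ziter f n"
  using ziter_add_1[OF assms, of "n - 1"] assms by (simp add: fun_eq_iff bij_is_inj)

lemma ziter_add:
  assumes "bij f"
  shows "ziter f (m + n) = ziter f m \<circ> ziter f n"
proof (induction m rule: int_induct[where k = 0])
  case (step1 i)
  then show ?case
    using ziter_add_1[OF assms, of i] ziter_add_1[OF assms, of "i + n"]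
    by (simp add: algebra_simps comp_assoc)
next
  case (step2 i)
  then show ?case
    using ziter_minus_1[OF assms, of i] ziter_minus_1[OF assms, of "i + n"]
    by (simp add: algebra_simps comp_assoc)
qed (simp add: ziter_0_apply fun_eq_iff)

lemma ziter_add_apply: "bij f \<Longrightarrow> ziter f m (ziter f n x) = ziter f (m + n) x"
  by (simp add: ziter_add)

lemma ziter_inv:
  assumes "bij f"
  shows "ziter (inv f) n = ziter f (- n)"
  using assms by (cases "n = 0") (auto simp: ziter_on_def inv_inv_eq)

lemma ziter_image:
  assumes "bij f" "f ` A = A" "x \<in> A"
  shows "ziter f n x \<in> A"
proof (induction n rule: int_induct[where k = 0])
  case (step1 i)
  then show ?case using ziter_add_1[OF assms(1)] assms(2) by (metis comp_apply image_eqI)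
next
  case (step2 i)
  then obtain y where "y \<in> A" "ziter f i x = f y" using assms(2) by blast
  then show ?case using ziter_minus_1[OF assms(1)] assms(1) by (simp add: bij_is_inj)
qed (use assms in \<open>simp add: ziter_0_apply\<close>)

lemma span_singleton_scaleR:
  assumes "s \<noteq> 0"
  shows "span {s *\<^sub>R v} = span {v}"
proof -
  have "v \<in> span {s *\<^sub>R v}"
    using span_mul[OF span_base, of "s *\<^sub>R v" "{s *\<^sub>R v}" "1 / s"] assms by simp
  moreover have "s *\<^sub>R v \<in> span {v}" by (simp add: span_base span_mul)
  ultimately show ?thesis by (simp add: span_eq)
qed

lemma open_nbhd: "open (nbhd r A)"
  by (auto simp: nbhd_def)

lemma C1_diffeo_inv: "C1_diffeo M f \<Longrightarrow> C1_diffeo M (inv f)"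
  by (simp add: C1_diffeo_def bij_imp_bij_inv inv_inv_eq)

lemma noncritical_part_iff:
  assumes "bij f"
  shows "x \<in> noncritical_part M f A \<delta> \<longleftrightarrow> (\<forall>n. ziter f n x \<in> A - nbhd \<delta> (Crit M f A))"
proof
  assume x: "x \<in> noncritical_part M f A \<delta>"
  show "\<forall>n. ziter f n x \<in> A - nbhd \<delta> (Crit M f A)"
  proof
    fix n
    have "x \<in> ziter f (- n) ` (A - nbhd \<delta> (Crit M f A))"
      using x by (auto simp: noncritical_part_def)
    then show "ziter f n x \<in> A - nbhd \<delta> (Crit M f A)"
      using assms by (auto simp: ziter_add_apply ziter_0_apply)
  qed
next
  assume *: "\<forall>n. ziter f n x \<in> A - nbhd \<delta> (Crit M f A)"
  have "x \<in> ziter f n ` (A - nbhd \<delta> (Crit M f A))" for n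
    using *[rule_format, of "- n"] assms by (intro image_eqI[of _ _ "ziter f (- n) x"]) (simp_all add: ziter_add_apply ziter_0_apply)
  then show "x \<in> noncritical_part M f A \<delta>" by (simp add: noncritical_part_def)
qed

lemma noncritical_part_ziter:
  assumes "bij f" "x \<in> noncritical_part M f A \<delta>"
  shows "ziter f n x \<in> noncritical_part M f A \<delta>"
  using assms by (simp add: noncritical_part_iff ziter_add_apply)

context riemannian_surface
begin

lemma C1_map_ziter:
  assumes "C1_diffeo M f"
  shows "C1_map M (ziter f n)"
proof (induction n rule: int_induct[where k = 0])
  case base
  show ?case unfolding ziter_0 by (rule C1_map_id)
next
  case (step1 i)
  then show ?case using assms C1_map_comp unfolding C1_diffeo_def by (metis ziter_add_1)
next
  case (step2 i)
  then show ?case using assms C1_map_comp unfolding C1_diffeo_def by (metis ziter_minus_1)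
qed

section \<open>Derivatives of integer iterates and their normalization\<close>

abbreviation tziter :: "('a \<Rightarrow> 'a) \<Rightarrow> int \<Rightarrow> 'a \<Rightarrow> real^2 \<Rightarrow> real^2" where
  "tziter f n \<equiv> tmap M (ziter f n)"

lemma linear_tziter: "C1_diffeo M f \<Longrightarrow> linear (tziter f n x)"
  by (intro linear_tmap C1_map_ziter)

lemma tziter_0: "tziter f 0 x v = v"
  unfolding ziter_0 by (simp add: tmap_id)

lemma tziter_add:
  assumes "C1_diffeo M f"
  shows "tziter f m (ziter f n x) (tziter f n x v) = tziter f (m + n) x v"
  using assms tmap_comp[OF C1_map_ziter C1_map_ziter, of f f m n x]
  by (simp add: C1_diffeo_def ziter_add)

lemma tziter_1: "tziter f 1 = tmap M f"
  using ziter_of_nat[of f 1] by simp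

lemma tziter_eq_0_iff:
  assumes "C1_diffeo M f"
  shows "tziter f n x v = 0 \<longleftrightarrow> v = 0"
  using tziter_add[OF assms, of "- n" n x v] linear_0[OF linear_tziter[OF assms]]
  by (auto simp: tziter_0 ziter_0_apply)

lemma tmap_eq_0_iff: "C1_diffeo M f \<Longrightarrow> tmap M f x v = 0 \<longleftrightarrow> v = 0"
  using tziter_eq_0_iff[of f 1] by (simp add: tziter_1)

lemma tmap_inv_tmap:
  assumes "C1_diffeo M f"
  shows "tmap M (inv f) (f x) (tmap M f x v) = v"
proof -
  have "inv f \<circ> f = id" using assms by (simp add: C1_diffeo_def bij_is_inj flip: inj_iff)
  then have "tmap M (inv f) (f x) \<circ> tmap M f x = id"
    using tmap_comp[of "inv f" f x] assms tmap_id by (simp add: C1_diffeo_def)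
  then show ?thesis by (simp add: fun_eq_iff)
qed

definition tunit :: "'a \<Rightarrow> real^2 \<Rightarrow> real^2" where
  "tunit x v = (1 / tnorm M x v) *\<^sub>R v"

lemma tnorm_tunit: "v \<noteq> 0 \<Longrightarrow> tnorm M x (tunit x v) = 1"
  using tnorm_pos[of v x] by (simp add: tunit_def tnorm_scaleR)

lemma tunit_scaleR: "a > 0 \<Longrightarrow> tunit x (a *\<^sub>R v) = tunit x v"
  by (simp add: tunit_def tnorm_scaleR)

lemma tunit_id: "tnorm M x v = 1 \<Longrightarrow> tunit x v = v"
  by (simp add: tunit_def)

lemma tunit_linear_tunit:
  "linear h \<Longrightarrow> v \<noteq> 0 \<Longrightarrow> tunit y (h (tunit x v)) = tunit y (h v)"
  unfolding tunit_def[of x] by (simp add: linear_scale tunit_scaleR tnorm_pos)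

lemma proj_cocycle_eq: "proj_cocycle M f (x, v) = (f x, tunit (f x) (tmap M f x v))"
  by (simp add: proj_cocycle_def tunit_def)

lemma unit_bundle_iff: "(x, v) \<in> unit_bundle M \<longleftrightarrow> tnorm M x v = 1"
  by (simp add: unit_bundle_def)

lemma unit_nonzero: "tnorm M x v = 1 \<Longrightarrow> v \<noteq> 0"
  using tnorm_eq_0_iff[of x v] by auto

lemma proj_cocycle_in_unit_bundle:
  assumes "C1_diffeo M f" "p \<in> unit_bundle M"
  shows "proj_cocycle M f p \<in> unit_bundle M"
  using assms by (cases p)
    (auto simp: unit_bundle_iff proj_cocycle_eq tmap_eq_0_iff intro!: tnorm_tunit dest: unit_nonzero)

lemma proj_cocycle_inv_cancel:
  assumes f: "C1_diffeo M f" and p: "p \<in> unit_bundle M"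
  shows "proj_cocycle M (inv f) (proj_cocycle M f p) = p"
proof -
  obtain x v where xv: "p = (x, v)" by fastforce
  have v: "tnorm M x v = 1" using p xv by (simp add: unit_bundle_iff)
  have "inv f (f x) = x" using f by (simp add: C1_diffeo_def bij_is_inj)
  moreover have "linear (tmap M (inv f) (f x))"
    using f linear_tmap by (simp add: C1_diffeo_def)
  ultimately show ?thesis
    using v unit_nonzero[OF v] f
    by (simp add: xv proj_cocycle_eq tunit_linear_tunit tmap_eq_0_iff tmap_inv_tmap tunit_id)
qed

text \<open>Negative iterates of the cocycle are defined by \<open>inv_into\<close> on the unit
  bundle, not through the inverse diffeomorphism. Cancellation with the cocycle of
  \<open>inv f\<close> gives both the injectivity and the preimage.\<close>

lemma inv_into_proj_cocycle:
  assumes f: "C1_diffeo M f" and p: "p \<in> unit_bundle M"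
  shows "inv_into (unit_bundle M) (proj_cocycle M f) p = proj_cocycle M (inv f) p"
proof (rule inv_into_f_eq)
  show "inj_on (proj_cocycle M f) (unit_bundle M)"
    by (rule inj_on_inverseI) (rule proj_cocycle_inv_cancel[OF f])
  show "proj_cocycle M (inv f) p \<in> unit_bundle M"
    by (rule proj_cocycle_in_unit_bundle[OF C1_diffeo_inv[OF f] p])
  show "proj_cocycle M f (proj_cocycle M (inv f) p) = p"
    using proj_cocycle_inv_cancel[OF C1_diffeo_inv[OF f] p] f by (simp add: C1_diffeo_def inv_inv_eq)
qed

lemma proj_cocycle_funpow:
  assumes f: "C1_diffeo M f" and v: "tnorm M x v = 1"
  shows "(proj_cocycle M f ^^ n) (x, v) = (ziter f (int n) x, tunit (ziter f (int n) x) (tziter f (int n) x v))"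
proof (induction n)
  case 0
  show ?case unfolding of_nat_0 tziter_0 by (simp add: ziter_0_apply tunit_id v)
next
  case (Suc n)
  let ?y = "ziter f (int n) x"
  have "f ?y = ziter f (int (Suc n)) x"
    using f ziter_add_1[of f "int n"] by (simp add: C1_diffeo_def add.commute)
  moreover have "tmap M f ?y (tziter f (int n) x v) = tziter f (int (Suc n)) x v"
    using tziter_add[OF f, of 1 "int n"] by (simp add: tziter_1)
  moreover have "linear (tmap M f ?y)" using f linear_tmap by (simp add: C1_diffeo_def)
  ultimately show ?case
    using Suc unit_nonzero[OF v]
    by (simp add: proj_cocycle_eq tunit_linear_tunit tziter_eq_0_iff[OF f])
qed

lemma Gpow_eq:
  assumes f: "C1_diffeo M f" and v: "tnorm M x v = 1"
  shows "Gpow M f n x v = tunit (ziter f n x) (tziter f n x v)"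
proof (cases "n \<ge> 0")
  case True
  then show ?thesis
    using proj_cocycle_funpow[OF f v, of "nat n"] by (simp add: Gpow_def ziter_on_def[of "unit_bundle M"])
next
  case False
  define k where "k = nat (- n)"
  have n: "n = - int k" using False by (simp add: k_def)
  let ?h = "inv_into (unit_bundle M) (proj_cocycle M f)"
  note g = C1_diffeo_inv[OF f]
  \<comment> \<open>Membership in the unit bundle is carried through the induction because
    \<open>inv_into\<close> is identified only there.\<close>
  have "(?h ^^ j) (x, v) = (proj_cocycle M (inv f) ^^ j) (x, v) \<and>
      (proj_cocycle M (inv f) ^^ j) (x, v) \<in> unit_bundle M" for j
  proof (induction j)
    case 0
    then show ?case using v by (simp add: unit_bundle_iff)
  next
    case (Suc j)
    then show ?case
      by (simp add: inv_into_proj_cocycle[OF f] proj_cocycle_in_unit_bundle[OF g])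
  qed
  then have "Gpow M f n x v = snd ((proj_cocycle M (inv f) ^^ k) (x, v))"
    using False by (simp add: Gpow_def ziter_on_def[of "unit_bundle M"] k_def)
  then show ?thesis
    using f by (simp add: proj_cocycle_funpow[OF g v] ziter_inv C1_diffeo_def n)
qed

lemma Gpow_inv:
  assumes "C1_diffeo M f" "tnorm M x v = 1"
  shows "Gpow M (inv f) n x v = Gpow M f (- n) x v"
  using assms Gpow_eq[OF C1_diffeo_inv[OF assms(1)] assms(2), of n]
  by (simp add: Gpow_eq) (simp add: C1_diffeo_def ziter_inv)

lemma Gpow_line_inv:
  assumes "C1_diffeo M f"
  shows "Gpow_line M (inv f) n x L = Gpow_line M f (- n) x L"
  unfolding Gpow_line_def using assms
  by (intro arg_cong[where f = span] image_cong) (auto simp: Gpow_inv)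

lemma unit_vectors_span:
  assumes "v \<noteq> 0"
  shows "{u \<in> span {v}. tnorm M x u = 1} = {tunit x v, - tunit x v}"
proof -
  have t: "tnorm M x v > 0" using tnorm_pos assms by blast
  have "u = tunit x v \<or> u = - tunit x v" if u: "u \<in> span {v}" "tnorm M x u = 1" for u
  proof -
    obtain s where s: "u = s *\<^sub>R v" using u by (auto simp: span_singleton)
    with u t have "s = 1 / tnorm M x v \<or> s = - (1 / tnorm M x v)"
      by (auto simp: tnorm_scaleR field_simps abs_if split: if_splits)
    then show ?thesis by (auto simp: s tunit_def)
  qed
  moreover have "tnorm M x (tunit x v) = 1" "tnorm M x (- tunit x v) = 1"
    using tnorm_tunit[OF assms] tnorm_scaleR[of x "-1" "tunit x v"] by auto
  moreover have "tunit x v \<in> span {v}" by (simp add: tunit_def span_base span_mul)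
  ultimately show ?thesis by (auto simp: span_neg)
qed

text \<open>The two unit vectors of the line have opposite images, which span the same line, and
  normalization does not change a span.\<close>

lemma Gpow_line_span:
  assumes f: "C1_diffeo M f" and v: "v \<noteq> 0"
  shows "Gpow_line M f n x (span {v}) = span {tziter f n x v}"
proof -
  let ?y = "ziter f n x"
  let ?a = "tunit ?y (tziter f n x v)"
  have u: "tnorm M x (tunit x v) = 1" "tnorm M x (- tunit x v) = 1"
    using unit_vectors_span[OF v] by auto
  have a: "tunit ?y (tziter f n x (tunit x v)) = ?a"
    by (rule tunit_linear_tunit[OF linear_tziter[OF f] v])
  have "tunit ?y (tziter f n x (- tunit x v)) = - ?a"
    using a tnorm_scaleR[of ?y "-1" "tziter f n x (tunit x v)"]
    by (simp add: linear_neg[OF linear_tziter[OF f]] tunit_def)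
  then have "Gpow_line M f n x (span {v}) = span {?a, - ?a}"
    using u a by (simp add: Gpow_line_def unit_vectors_span[OF v] Gpow_eq[OF f])
  also have "\<dots> = span {?a}"
    using span_redundant[of "- ?a" "{?a}"] by (simp add: insert_commute span_neg span_base)
  also have "\<dots> = span {tziter f n x v}"
    using tnorm_pos[of "tziter f n x v" ?y] v
    by (simp add: tunit_def tziter_eq_0_iff[OF f] span_singleton_scaleR)
  finally show ?thesis .
qed

section \<open>The derivative of the projective cocycle as an area ratio\<close>

lemma gram_pos:
  assumes "u \<noteq> 0" "w \<notin> span {u}"
  shows "gram x u w > 0"
proof -
  define a where "a = rmetric M x u u"
  have a: "a > 0" using assms positive_metric by (simp add: a_def)
  let ?z = "w - (rmetric M x u w / a) *\<^sub>R u"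
  have "?z \<noteq> 0"
    using assms(2) span_mul[OF span_base, of u "{u}" "rmetric M x u w / a"] by auto
  moreover have "gram x u w = a * rmetric M x ?z ?z"
    using a symmetric_metric[of x u w]
    by (simp add: gram_def rmetric_simps power2_eq_square field_simps flip: a_def)
  ultimately show ?thesis using a positive_metric by simp
qed

lemma unit_orthogonal_exists:
  assumes "v \<noteq> 0"
  shows "\<exists>w. tnorm M x w = 1 \<and> rmetric M x v w = 0"
proof -
  have "span {v} \<noteq> UNIV"
  proof
    assume "span {v} = UNIV"
    then have "dim (UNIV :: (real^2) set) = dim {v}" by (metis dim_span)
    then show False using assms by (simp add: dim_singleton)
  qed
  then obtain u where u: "u \<notin> span {v}" by auto
  define z where "z = u - (rmetric M x v u / rmetric M x v v) *\<^sub>R v"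
  have "z \<noteq> 0"
    using u span_mul[OF span_base, of v "{v}" "rmetric M x v u / rmetric M x v v"]
    by (auto simp: z_def)
  moreover have "rmetric M x v z = 0"
    using positive_metric[OF assms, of x] by (simp add: z_def rmetric_simps)
  ultimately show ?thesis
    by (intro exI[of _ "tunit x z"]) (simp add: tnorm_tunit, simp add: tunit_def rmetric_simps)
qed

text \<open>Put a = Av and b = Aw. The derivative at 0 of the normalized curve cos \<theta> a + sin
  \<theta> b is the component of b orthogonal to a, divided by |a|. Its length is area(a, b) /
  |a|^2, which is |det A| / |Av|^2 because \<open>v\<close> and \<open>w\<close> are orthonormal.
  The vector \<open>w\<close> is the one picked by \<open>SOME\<close> in
  \<open>gder\<close>.\<close>

lemma gder_eq:
  assumes f: "C1_diffeo M f" and v: "tnorm M x v = 1"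
  obtains w where "tnorm M x w = 1" "rmetric M x v w = 0"
    "gder M f n x v = sqrt (gram (ziter f n x) (tziter f n x v) (tziter f n x w)) /
      rmetric M (ziter f n x) (tziter f n x v) (tziter f n x v)"
proof -
  define w where "w = (SOME w. tnorm M x w = 1 \<and> rmetric M x v w = 0)"
  have w: "tnorm M x w = 1" "rmetric M x v w = 0"
    using someI_ex[OF unit_orthogonal_exists[OF unit_nonzero[OF v]], of x] by (auto simp: w_def)
  define y where "y = ziter f n x"
  define a b where "a = tziter f n x v" and "b = tziter f n x w"
  define p q r where "p = rmetric M y a a" and "q = rmetric M y a b" and "r = rmetric M y b b"
  have p: "p > 0"
    using positive_metric unit_nonzero[OF v] tziter_eq_0_iff[OF f] by (simp add: p_def a_def)
  have unit: "tnorm M x (cos \<theta> *\<^sub>R v + sin \<theta> *\<^sub>R w) = 1" for \<theta>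
  proof -
    have "(tnorm M x (cos \<theta> *\<^sub>R v + sin \<theta> *\<^sub>R w))\<^sup>2 =
        (cos \<theta>)\<^sup>2 * (tnorm M x v)\<^sup>2 + (sin \<theta>)\<^sup>2 * (tnorm M x w)\<^sup>2"
      using w(2) symmetric_metric[of x w v]
      unfolding tnorm_power2 by (simp add: rmetric_simps power2_eq_square)
    then have "(tnorm M x (cos \<theta> *\<^sub>R v + sin \<theta> *\<^sub>R w))\<^sup>2 = 1" using v w by simp
    then show ?thesis using tnorm_nonneg by (metis abs_of_nonneg real_sqrt_abs real_sqrt_one)
  qed
  \<comment> \<open>\<open>?Q \<theta>\<close> is the squared norm of cos \<theta> a + sin \<theta>
    b, the square of the denominator in the normalization.\<close>
  let ?Q = "\<lambda>\<theta>. (cos \<theta>)\<^sup>2 * p + 2 * (sin \<theta> * cos \<theta> * q) + (sin \<theta>)\<^sup>2 * r"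
  have G: "Gpow M f n x (cos \<theta> *\<^sub>R v + sin \<theta> *\<^sub>R w) =
      (cos \<theta> / sqrt (?Q \<theta>)) *\<^sub>R a + (sin \<theta> / sqrt (?Q \<theta>)) *\<^sub>R b" for \<theta>
  proof -
    have "tziter f n x (cos \<theta> *\<^sub>R v + sin \<theta> *\<^sub>R w) = cos \<theta> *\<^sub>R a + sin \<theta> *\<^sub>R b"
      by (simp add: linear_add[OF linear_tziter[OF f]] linear_scale[OF linear_tziter[OF f]] a_def b_def)
    moreover have "tnorm M y (cos \<theta> *\<^sub>R a + sin \<theta> *\<^sub>R b) = sqrt (?Q \<theta>)"
      using symmetric_metric[of y b a]
      by (simp add: tnorm_def rmetric_simps p_def q_def r_def power2_eq_square algebra_simps)
    ultimately show ?thesis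
      by (simp add: Gpow_eq[OF f unit] tunit_def scaleR_add_right flip: y_def)
  qed
  define s where "s = sqrt p"
  have s: "s > 0" "s\<^sup>2 = p" using p by (simp_all add: s_def)
  have Q: "((\<lambda>\<theta>. sqrt (?Q \<theta>)) has_field_derivative q / s) (at 0)"
    using p by (auto intro!: derivative_eq_intros simp: s_def field_simps)
  have Q0: "sqrt (?Q 0) = s" by (simp add: s_def)
  have D1: "((\<lambda>\<theta>. cos \<theta> / sqrt (?Q \<theta>)) has_field_derivative (- q / s ^ 3)) (at 0)"
    by (rule DERIV_cong[OF DERIV_divide[OF DERIV_cos Q]], unfold Q0)
       (use s in \<open>simp_all add: field_simps power3_eq_cube\<close>)
  have D2: "((\<lambda>\<theta>. sin \<theta> / sqrt (?Q \<theta>)) has_field_derivative (1 / s)) (at 0)"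
    by (rule DERIV_cong[OF DERIV_divide[OF DERIV_sin Q]], unfold Q0)
       (use s in \<open>simp_all add: field_simps\<close>)
  have "((\<lambda>\<theta>. Gpow M f n x (cos \<theta> *\<^sub>R v + sin \<theta> *\<^sub>R w)) has_vector_derivative
      (- q / s ^ 3) *\<^sub>R a + (1 / s) *\<^sub>R b) (at 0)"
    unfolding G
    using has_vector_derivative_add[OF
        has_vector_derivative_scaleR[OF D1 has_vector_derivative_const[of a]]
        has_vector_derivative_scaleR[OF D2 has_vector_derivative_const[of b]]]
    by simp
  then have "gder M f n x v = tnorm M y ((- q / s ^ 3) *\<^sub>R a + (1 / s) *\<^sub>R b)"
    by (simp add: gder_def w_def[symmetric] vector_derivative_at flip: y_def)
  also have "\<dots> = sqrt ((p * r - q\<^sup>2) / p\<^sup>2)"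
  proof -
    have "rmetric M y ((- q / s ^ 3) *\<^sub>R a + (1 / s) *\<^sub>R b) ((- q / s ^ 3) *\<^sub>R a + (1 / s) *\<^sub>R b) =
        (q / s ^ 3)\<^sup>2 * s\<^sup>2 - 2 * (q / s ^ 3) * (1 / s) * q + (1 / s)\<^sup>2 * r"
      using symmetric_metric[of y b a]
      by (simp add: rmetric_simps power2_eq_square algebra_simps flip: p_def q_def r_def s(2))
    also have "\<dots> = (s\<^sup>2 * r - q\<^sup>2) / (s\<^sup>2)\<^sup>2"
      using s(1) by (simp add: field_simps power2_eq_square power3_eq_cube)
    finally show ?thesis by (simp add: tnorm_def s(2))
  qed
  also have "\<dots> = sqrt (gram y a b) / p"
    using p by (simp add: real_sqrt_divide gram_def p_def q_def r_def)
  finally show ?thesis using that w by (simp add: a_def b_def y_def p_def)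
qed

text \<open>The condition \<open>gder \<ge> 1\<close> reads \<open>\<bar>Av\<bar>\<^sup>4 area(v, w)\<^sup>2 \<le> \<bar>v\<bar>\<^sup>4 area(Av, Aw)\<^sup>2\<close>, where
  \<open>A\<close> is the derivative of the iterate and \<open>gram\<close> is the squared area. Both sides scale alike in
  \<open>v\<close> and in \<open>w\<close>, so this form needs neither unit vectors nor orthogonality and passes to limits.\<close>

definition critical_vector :: "('a \<Rightarrow> 'a) \<Rightarrow> 'a \<Rightarrow> real^2 \<Rightarrow> bool" where
  "critical_vector f x v \<longleftrightarrow> v \<noteq> 0 \<and> (\<forall>n w.
     gram x v w * (rmetric M (ziter f n x) (tziter f n x v) (tziter f n x v))\<^sup>2 \<le>
     (rmetric M x v v)\<^sup>2 * gram (ziter f n x) (tziter f n x v) (tziter f n x w))"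

lemma critical_vector_scaleR:
  assumes f: "C1_diffeo M f" and v: "critical_vector f x v" and s: "s \<noteq> 0"
  shows "critical_vector f x (s *\<^sub>R v)"
proof -
  have "gram x (s *\<^sub>R v) w * (rmetric M (ziter f n x) (tziter f n x (s *\<^sub>R v)) (tziter f n x (s *\<^sub>R v)))\<^sup>2 \<le>
     (rmetric M x (s *\<^sub>R v) (s *\<^sub>R v))\<^sup>2 * gram (ziter f n x) (tziter f n x (s *\<^sub>R v)) (tziter f n x w)"
    (is "?L \<le> ?R") for n w
  proof -
    \<comment> \<open>Both sides have degree 6 in the scaled vector: 2 from the squared area and 4
      from the fourth power of the norm.\<close>
    have "?L = s ^ 6 * (gram x v w * (rmetric M (ziter f n x) (tziter f n x v) (tziter f n x v))\<^sup>2)"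
      by (simp add: linear_scale[OF linear_tziter[OF f]] gram_scaleR_left rmetric_simps
          eval_nat_numeral algebra_simps)
    also have "\<dots> \<le> s ^ 6 *
        ((rmetric M x v v)\<^sup>2 * gram (ziter f n x) (tziter f n x v) (tziter f n x w))"
      using v by (intro mult_left_mono) (auto simp: critical_vector_def)
    also have "\<dots> = ?R"
      by (simp add: linear_scale[OF linear_tziter[OF f]] gram_scaleR_left rmetric_simps
          eval_nat_numeral algebra_simps)
    finally show ?thesis .
  qed
  then show ?thesis using v s by (simp add: critical_vector_def)
qed

lemma critical_direction_iff:
  assumes f: "C1_diffeo M f"
  shows "critical_direction M f x v \<longleftrightarrow> tnorm M x v = 1 \<and> critical_vector f x v"
proof (cases "tnorm M x v = 1")
  case True
  have vv: "rmetric M x v v = 1" using True tnorm_power2[of x v] by simp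
  have "gder M f n x v \<ge> 1 \<longleftrightarrow>
      (\<forall>u. gram x v u * (rmetric M (ziter f n x) (tziter f n x v) (tziter f n x v))\<^sup>2 \<le>
        gram (ziter f n x) (tziter f n x v) (tziter f n x u))" for n
  proof -
    obtain w where w: "tnorm M x w = 1" "rmetric M x v w = 0" and
      g: "gder M f n x v = sqrt (gram (ziter f n x) (tziter f n x v) (tziter f n x w)) /
        rmetric M (ziter f n x) (tziter f n x v) (tziter f n x v)"
      using gder_eq[OF f True] by blast
    let ?p = "rmetric M (ziter f n x) (tziter f n x v) (tziter f n x v)"
    let ?g = "\<lambda>u. gram (ziter f n x) (tziter f n x v) (tziter f n x u)"
    have p: "?p > 0" using positive_metric unit_nonzero[OF True] tziter_eq_0_iff[OF f] by simp
    have "gder M f n x v \<ge> 1 \<longleftrightarrow> ?p \<le> sqrt (?g w)" using p by (simp add: g le_divide_eq_1)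
    also have "\<dots> \<longleftrightarrow> ?p\<^sup>2 \<le> ?g w"
      using p real_sqrt_le_iff[of "?p\<^sup>2" "?g w"] by simp
    also have "\<dots> \<longleftrightarrow> (\<forall>u. gram x v u * ?p\<^sup>2 \<le> ?g u)"
    proof
      assume le: "?p\<^sup>2 \<le> ?g w"
      show "\<forall>u. gram x v u * ?p\<^sup>2 \<le> ?g u"
      proof
        fix u
        have "w \<notin> span {v}"
        proof
          assume "w \<in> span {v}"
          then obtain s where "w = s *\<^sub>R v" by (auto simp: span_singleton)
          then show False using w vv unit_nonzero[OF w(1)] by (simp add: rmetric_simps)
        qed
        \<comment> \<open>The inequality for the single \<open>w\<close> yields it for every
          \<open>u\<close>: the multiple of \<open>v\<close> changes no area, and the factor
          \<open>t\<close> multiplies both squared areas by \<open>t\<^sup>2\<close>.\<close>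
        then obtain s t where u: "u = s *\<^sub>R v + t *\<^sub>R w"
          using spans_plane unit_nonzero[OF True] by blast
        have "gram x v w = 1" using w vv tnorm_power2[of x w] by (simp add: gram_def)
        then have "gram x v u = t\<^sup>2" by (simp add: u gram_combination)
        moreover have "?g u = t\<^sup>2 * ?g w"
          by (simp add: u linear_add[OF linear_tziter[OF f]] linear_scale[OF linear_tziter[OF f]]
              gram_combination)
        ultimately show "gram x v u * ?p\<^sup>2 \<le> ?g u" using le by (simp add: mult_left_mono)
      qed
    next
      assume "\<forall>u. gram x v u * ?p\<^sup>2 \<le> ?g u"
      then show "?p\<^sup>2 \<le> ?g w" using w vv tnorm_power2[of x w] by (auto simp: gram_def dest: spec[of _ w])
    qed
    finally show ?thesis .
  qed
  then show ?thesis
    using True unit_nonzero[OF True] by (simp add: critical_direction_def critical_vector_def vv)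
qed (simp add: critical_direction_def)

lemma critical_direction_tunit:
  assumes "C1_diffeo M f" "critical_vector f x v"
  shows "critical_direction M f x (tunit x v)"
proof -
  have "v \<noteq> 0" using assms by (simp add: critical_vector_def)
  then show ?thesis
    using assms tnorm_tunit tnorm_pos[of v x] critical_vector_scaleR[OF assms, of "1 / tnorm M x v"]
    by (auto simp: critical_direction_iff tunit_def)
qed

lemma Crit_iff:
  assumes "C1_diffeo M f"
  shows "x \<in> Crit M f A \<longleftrightarrow> x \<in> A \<and> (\<exists>v. critical_vector f x v)"
  using critical_direction_tunit[OF assms] assms by (auto simp: Crit_def critical_direction_iff)

text \<open>The condition ranges over all integers and is therefore symmetric under reversal of
  time.\<close>

lemma critical_vector_inv:
  assumes "C1_diffeo M f"
  shows "critical_vector (inv f) x v \<longleftrightarrow> critical_vector f x v"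
  using assms unfolding critical_vector_def
  by (simp add: ziter_inv C1_diffeo_def) (metis minus_minus)

lemma critical_direction_inv:
  assumes "C1_diffeo M f"
  shows "critical_direction M (inv f) = critical_direction M f"
  using assms by (simp add: fun_eq_iff critical_direction_iff C1_diffeo_inv critical_vector_inv)

lemma Crit_inv: "C1_diffeo M f \<Longrightarrow> Crit M (inv f) A = Crit M f A"
  by (simp add: Crit_def critical_direction_inv)

lemma noncritical_part_inv:
  assumes f: "C1_diffeo M f"
  shows "noncritical_part M (inv f) A \<delta> = noncritical_part M f A \<delta>"
proof -
  have "bij f" "bij (inv f)" using f by (auto simp: C1_diffeo_def bij_imp_bij_inv)
  then show ?thesis
    using Crit_inv[OF f] by (auto simp: noncritical_part_iff ziter_inv) (metis minus_minus)+
qed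

text \<open>Each defining inequality is between continuous expressions, so it passes to the limit
  once the test vector \<open>w\<close> at \<open>x\<close> is approximated by test vectors at
  \<open>X k\<close>.\<close>

lemma critical_vector_limit:
  assumes f: "C1_diffeo M f" and V: "tvec_tendsto X V x v" "v \<noteq> 0"
    and crit: "\<And>k. critical_vector f (X k) (V k)"
  shows "critical_vector f x v"
  unfolding critical_vector_def
proof (intro conjI allI V)
  fix n w
  obtain W where W: "tvec_tendsto X W x w"
    using tvec_tendsto_exists tvec_tendstoD(1)[OF V(1)] by blast
  note D = tvec_tendsto_tmap[OF C1_map_ziter[OF f, of n]]
  show "gram x v w * (rmetric M (ziter f n x) (tziter f n x v) (tziter f n x v))\<^sup>2 \<le>
      (rmetric M x v v)\<^sup>2 * gram (ziter f n x) (tziter f n x v) (tziter f n x w)"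
  proof (rule LIMSEQ_le)
    show "(\<lambda>k. gram (X k) (V k) (W k) * (rmetric M (ziter f n (X k)) (tziter f n (X k) (V k))
        (tziter f n (X k) (V k)))\<^sup>2) \<longlonglongrightarrow> gram x v w *
        (rmetric M (ziter f n x) (tziter f n x v) (tziter f n x v))\<^sup>2"
      by (intro tendsto_mult tendsto_power gram_tendsto rmetric_tendsto D V W)
    show "(\<lambda>k. (rmetric M (X k) (V k) (V k))\<^sup>2 * gram (ziter f n (X k)) (tziter f n (X k) (V k))
        (tziter f n (X k) (W k))) \<longlonglongrightarrow>
        (rmetric M x v v)\<^sup>2 * gram (ziter f n x) (tziter f n x v) (tziter f n x w)"
      by (intro tendsto_mult tendsto_power gram_tendsto rmetric_tendsto D V W)
  qed (use crit in \<open>auto simp: critical_vector_def\<close>)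
qed

text \<open>The squared area of (Av, Aw) is at most |Av|^2 |Aw|^2, so one factor |Av|^2 cancels in
  the critical inequality. The resulting \<open>B\<close> is |v|^2 divided by the area of (v, w),
  the same for all integers \<open>n\<close>.\<close>

lemma critical_vector_bound:
  assumes v: "critical_vector f x v" and w: "w \<notin> span {v}"
  obtains B where "\<And>n. tnorm M (ziter f n x) (tziter f n x v) \<le>
    B * tnorm M (ziter f n x) (tziter f n x w)"
proof
  fix n
  define t where "t = gram x v w"
  have t: "t > 0" using gram_pos v w by (simp add: t_def critical_vector_def)
  let ?a = "tnorm M (ziter f n x) (tziter f n x v)"
  let ?b = "tnorm M (ziter f n x) (tziter f n x w)"
  let ?c = "rmetric M x v v"
  show "?a \<le> (?c / sqrt t) * ?b"
  proof (cases "?a = 0")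
    case True
    then show ?thesis using t rmetric_nonneg tnorm_nonneg by simp
  next
    case False
    have "t * (?a\<^sup>2)\<^sup>2 \<le> ?c\<^sup>2 * gram (ziter f n x) (tziter f n x v) (tziter f n x w)"
      using v by (simp add: critical_vector_def t_def tnorm_power2)
    also have "\<dots> \<le> ?c\<^sup>2 * (?a\<^sup>2 * ?b\<^sup>2)"
      by (intro mult_left_mono) (simp_all add: gram_def tnorm_power2)
    finally have "?a\<^sup>2 * (t * ?a\<^sup>2) \<le> ?a\<^sup>2 * (?c\<^sup>2 * ?b\<^sup>2)"
      by (simp add: power2_eq_square algebra_simps)
    then have "t * ?a\<^sup>2 \<le> ?c\<^sup>2 * ?b\<^sup>2"
      using False by (simp add: mult_le_cancel_left)
    then have "(sqrt t * ?a)\<^sup>2 \<le> (?c * ?b)\<^sup>2" using t by (simp add: power_mult_distrib)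
    then have "sqrt t * ?a \<le> ?c * ?b"
      using rmetric_nonneg tnorm_nonneg by (meson mult_nonneg_nonneg power2_le_imp_le)
    then show ?thesis using t by (simp add: field_simps)
  qed
qed

end

section \<open>Backward orbits of critical points\<close>

context riemannian_surface
begin

text \<open>By invariance each vector of the line is the image of a vector of the line one step
  earlier, and since the derivative is invertible this vector is the backward image. Only the
  backward orbit enters, so the lemma applies both on the invariant set and along an orbit that
  merely stays in \<open>U\<close>.\<close>

lemma tziter_backward_mem:
  assumes f: "C1_diffeo M f" and a: "a \<in> L x"
    and inv: "\<And>i. tmap M f (ziter f (- int (Suc i)) x) ` L (ziter f (- int (Suc i)) x) =
      L (ziter f (- int i) x)"
  shows "tziter f (- int i) x a \<in> L (ziter f (- int i) x)"
proof (induction i)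
  case 0
  show ?case unfolding of_nat_0 minus_zero tziter_0 using a by (simp add: ziter_0_apply)
next
  case (Suc i)
  let ?y = "ziter f (- int (Suc i)) x"
  obtain b where b: "b \<in> L ?y" "tziter f (- int i) x a = tmap M f ?y b"
    using Suc inv[of i] by blast
  have bij: "bij f" using f by (simp add: C1_diffeo_def)
  have y: "ziter f 1 ?y = ziter f (- int i) x" by (simp add: ziter_add_apply[OF bij])
  have "tziter f (- int (Suc i)) x a = tziter f (-1) (ziter f (- int i) x) (tziter f (- int i) x a)"
    using tziter_add[OF f, of "-1" "- int i" x a] by (simp add: algebra_simps)
  also have "\<dots> = tziter f 0 ?y b"
    using tziter_add[OF f, of "-1" 1 ?y b] unfolding y by (simp add: b(2) tziter_1)
  also have "\<dots> = b" by (rule tziter_0)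
  finally show ?case using b(1) by simp
qed

text \<open>For fixed \<open>n\<close> the points f^(n - r k)(c) are at negative times once r k > n,
  hence outside the neighbourhood of \<open>Crit\<close>; this closed condition passes to f^n of the
  limit. Choosing the subsequence among the failures of \<open>P\<close> makes this a tool for
  proving that \<open>P\<close> holds eventually.\<close>

lemma backward_limit:
  assumes f: "C1_diffeo M f" and A: "compact A" "f ` A = A" and c: "c \<in> A"
    and avoid: "\<And>j. 0 < j \<Longrightarrow> ziter f (- int j) c \<notin> nbhd \<delta> (Crit M f A)"
    and P: "\<not> eventually P sequentially"
  obtains r y where "strict_mono r" "\<And>k. \<not> P (r k)" "y \<in> noncritical_part M f A \<delta>"
    "(\<lambda>k. ziter f (- int (r k)) c) \<longlonglongrightarrow> y"
proof -
  have bij: "bij f" using f by (simp add: C1_diffeo_def)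
  have "infinite {k. \<not> P k}"
    using P by (simp add: eventually_sequentially infinite_nat_iff_unbounded_le)
  then obtain s :: "nat \<Rightarrow> nat" where s: "strict_mono s" "\<And>k. \<not> P (s k)"
    using infinite_enumerate by blast
  have "ziter f (- int (s k)) c \<in> A" for k using ziter_image[OF bij A(2) c] .
  then obtain y t where y: "y \<in> A" "strict_mono t" "((\<lambda>k. ziter f (- int (s k)) c) \<circ> t) \<longlonglongrightarrow> y"
    using A(1) unfolding compact_eq_seq_compact_metric seq_compact_def by metis
  have r: "strict_mono (s \<circ> t)" using s y by (simp add: strict_mono_o)
  have lim: "(\<lambda>k. ziter f (- int ((s \<circ> t) k)) c) \<longlonglongrightarrow> y" using y(3) by (simp add: comp_def)
  have "ziter f n y \<in> A - nbhd \<delta> (Crit M f A)" for n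
  proof -
    have "closed (A - nbhd \<delta> (Crit M f A))"
      by (intro closed_Diff compact_imp_closed A open_nbhd)
    moreover have "(\<lambda>k. ziter f n (ziter f (- int ((s \<circ> t) k)) c)) \<longlonglongrightarrow> ziter f n y"
      by (rule isCont_tendsto_compose[OF isCont_C1_map[OF C1_map_ziter[OF f]] lim])
    moreover have "\<forall>\<^sub>F k in sequentially.
        ziter f n (ziter f (- int ((s \<circ> t) k)) c) \<in> A - nbhd \<delta> (Crit M f A)"
      using eventually_gt_at_top[of "nat n"]
    proof eventually_elim
      case (elim k)
      then have less: "nat n < (s \<circ> t) k" using seq_suble[OF r, of k] by linarith
      \<comment> \<open>Strict positivity of \<open>j\<close> matters: \<open>c\<close> will itself
        be critical, so time 0 is not covered by \<open>avoid\<close>.\<close>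
      define j where "j = nat (int ((s \<circ> t) k) - n)"
      have j: "0 < j" "n + - int ((s \<circ> t) k) = - int j" using less by (auto simp: j_def)
      have "ziter f n (ziter f (- int ((s \<circ> t) k)) c) = ziter f (- int j) c"
        unfolding ziter_add_apply[OF bij] j(2) ..
      then show ?case using avoid[OF j(1)] ziter_image[OF bij A(2) c] by simp
    qed
    ultimately show ?thesis
      by (intro Lim_in_closed_set[of "A - nbhd \<delta> (Crit M f A)"]) auto
  qed
  then have "y \<in> noncritical_part M f A \<delta>" by (simp add: noncritical_part_iff[OF bij])
  then show ?thesis using that[OF r _ _ lim] s by simp
qed

text \<open>The slack between 1/4 and 1/2 lets the inequality survive off the invariant set. If 1/2
  failed along a subsequence, the two growth products g and h at the limit would satisfy g / 2 \<le>
  h \<le> g / 4 with g > 0.\<close>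

lemma backward_domination:
  assumes f: "C1_diffeo M f" and A: "compact A" "f ` A = A" and c: "c \<in> A"
    and avoid: "\<And>j. 0 < j \<Longrightarrow> ziter f (- int j) c \<notin> nbhd \<delta> (Crit M f A)"
    and \<epsilon>: "\<epsilon> > 0" "nbhd \<epsilon> (noncritical_part M f A \<delta>) \<subseteq> U"
    and split: "splitting M U E F"
    and dom: "\<And>x e w. x \<in> noncritical_part M f A \<delta> \<Longrightarrow> e \<in> E x \<Longrightarrow> w \<in> F x \<Longrightarrow>
      tnorm M (ziter f (int N) x) (tziter f (int N) x e) * tnorm M x w \<le>
      1 / 4 * (tnorm M (ziter f (int N) x) (tziter f (int N) x w) * tnorm M x e)"
  shows "\<forall>\<^sub>F j in sequentially. let x = ziter f (- int j) c in
    x \<in> nbhd \<epsilon> (noncritical_part M f A \<delta>) \<and>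
    (\<forall>e\<in>E x. \<forall>w\<in>F x. tnorm M (ziter f (int N) x) (tziter f (int N) x e) * tnorm M x w \<le>
      1 / 2 * (tnorm M (ziter f (int N) x) (tziter f (int N) x w) * tnorm M x e))"
    (is "eventually ?P _")
proof (rule ccontr)
  let ?K = "noncritical_part M f A \<delta>"
  assume "\<not> eventually ?P sequentially"
  then obtain r y where r: "strict_mono r" "\<And>k. \<not> ?P (r k)" "y \<in> ?K"
    and lim: "(\<lambda>k. ziter f (- int (r k)) c) \<longlonglongrightarrow> y"
    using backward_limit[OF f A c avoid, of ?P] by blast
  have y_nbhd: "y \<in> nbhd \<epsilon> ?K" using r(3) \<epsilon>(1) by (auto simp: nbhd_def intro!: bexI[of _ y])
  \<comment> \<open>Dropping \<open>k0\<close> terms puts every remaining point into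
    \<open>U\<close>, where the line fields are continuous.\<close>
  then obtain k0 where k0: "\<And>k. k \<ge> k0 \<Longrightarrow> ziter f (- int (r k)) c \<in> nbhd \<epsilon> ?K"
    using topological_tendstoD[OF lim open_nbhd y_nbhd] unfolding eventually_sequentially by blast
  define X where "X k = ziter f (- int (r (k + k0))) c" for k
  have X: "X \<longlonglongrightarrow> y" unfolding X_def by (rule LIMSEQ_ignore_initial_segment[OF lim])
  have XU: "X k \<in> U" "y \<in> U" for k using k0[of "k + k0"] y_nbhd \<epsilon>(2) by (auto simp: X_def)
  have lines: "x \<in> U \<Longrightarrow> subspace (E x) \<and> dim (E x) = 1" "x \<in> U \<Longrightarrow> subspace (F x) \<and> dim (F x) = 1" for x
    using split by (auto simp: splitting_def)
  have cl: "continuous_lines M U E" "continuous_lines M U F" using split by (auto simp: splitting_def)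
  let ?g = "\<lambda>x e w. tnorm M (ziter f (int N) x) (tziter f (int N) x e) * tnorm M x w"
  obtain e where e: "e \<in> E y" "e \<noteq> 0" using dim1_obtain lines(1)[OF XU(2)] by metis
  obtain w where w: "w \<in> F y" "w \<noteq> 0" using dim1_obtain lines(2)[OF XU(2)] by metis
  obtain V where V: "\<And>k. V k \<in> E (X k)" "tvec_tendsto X V y e"
    using continuous_lines_lift[OF cl(1) lines(1) X XU e] by blast
  obtain W where W: "\<And>k. W k \<in> F (X k)" "tvec_tendsto X W y w"
    using continuous_lines_lift[OF cl(2) lines(2) X XU w] by blast
  note D = tvec_tendsto_tmap[OF C1_map_ziter[OF f, of "int N"]]
  have g: "(\<lambda>k. ?g (X k) (V k) (W k)) \<longlonglongrightarrow> ?g y e w" "(\<lambda>k. ?g (X k) (W k) (V k)) \<longlonglongrightarrow> ?g y w e"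
    by (intro tendsto_mult tnorm_tendsto D V W)+
  have nz: "\<forall>\<^sub>F k in sequentially. V k \<noteq> 0 \<and> W k \<noteq> 0"
  proof -
    have "\<forall>\<^sub>F k in sequentially. 0 < tnorm M (X k) (V k)" "\<forall>\<^sub>F k in sequentially. 0 < tnorm M (X k) (W k)"
      using order_tendstoD(1)[OF tnorm_tendsto] V(2) W(2) tnorm_pos e w by blast+
    then show ?thesis by eventually_elim (metis less_irrefl tnorm_eq_0_iff)
  qed
  have gt: "\<forall>\<^sub>F k in sequentially. 1 / 2 * ?g (X k) (W k) (V k) \<le> ?g (X k) (V k) (W k)"
    using nz
  proof eventually_elim
    case (elim k)
    obtain e' w' where ew: "e' \<in> E (X k)" "w' \<in> F (X k)"
        "1 / 2 * ?g (X k) w' e' < ?g (X k) e' w'"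
      using r(2)[of "k + k0"] k0[of "k + k0"] by (auto simp: X_def Let_def not_le)
    \<comment> \<open>The failure concerns some \<open>e'\<close> and \<open>w'\<close>. The lines
      are one-dimensional and \<open>?g\<close> is homogeneous in each vector, so after cancelling
      the common factor it passes, as a weak inequality, to the convergent \<open>V k\<close> and
      \<open>W k\<close>.\<close>
    have "E (X k) = span {V k}" "F (X k) = span {W k}"
      using dim1_span lines XU V W elim by blast+
    then obtain s t where st: "e' = s *\<^sub>R V k" "w' = t *\<^sub>R W k"
      using ew by (auto simp: span_singleton)
    have "?g (X k) e' w' = \<bar>s * t\<bar> * ?g (X k) (V k) (W k)" "?g (X k) w' e' = \<bar>s * t\<bar> * ?g (X k) (W k) (V k)"
      by (simp_all add: st linear_scale[OF linear_tziter[OF f]] tnorm_scaleR abs_mult)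
    with ew(3) have "\<bar>s * t\<bar> * (1 / 2 * ?g (X k) (W k) (V k)) < \<bar>s * t\<bar> * ?g (X k) (V k) (W k)"
      by simp
    then show ?case by (meson abs_ge_zero mult_left_mono not_le less_le_trans linorder_le_cases)
  qed
  have "1 / 2 * ?g y w e \<le> ?g y e w"
    by (rule tendsto_le[OF _ g(1) tendsto_mult[OF tendsto_const g(2)] gt]) simp
  also have "\<dots> \<le> 1 / 4 * ?g y w e" by (rule dom[OF r(3) e(1) w(1)])
  finally have "?g y w e \<le> 0" by linarith
  moreover have "?g y w e > 0"
    using e w by (intro mult_pos_pos tnorm_pos) (simp_all add: tziter_eq_0_iff[OF f])
  ultimately show False by simp
qed

text \<open>Backwards in time every direction other than \<open>F\<close> is attracted by \<open>E\<close>, and along it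
  the projective cocycle contracts; so only \<open>F\<close> can be critical.\<close>

lemma critical_vector_in_F:
  assumes f: "C1_diffeo M f" and A: "compact A" "f ` A = A" and c: "c \<in> A"
    and avoid: "\<And>j. 0 < j \<Longrightarrow> ziter f (- int j) c \<notin> nbhd \<delta> (Crit M f A)"
    and \<epsilon>: "\<epsilon> > 0" "nbhd \<epsilon> (noncritical_part M f A \<delta>) \<subseteq> U"
    and split: "splitting M U E F"
    and inv: "\<And>x. x \<in> U \<Longrightarrow> f x \<in> U \<Longrightarrow> tmap M f x ` E x = E (f x) \<and> tmap M f x ` F x = F (f x)"
    and dom: "\<And>x e w. x \<in> noncritical_part M f A \<delta> \<Longrightarrow> e \<in> E x \<Longrightarrow> w \<in> F x \<Longrightarrow>
      tnorm M (ziter f (int N) x) (tziter f (int N) x e) * tnorm M x w \<le>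
      1 / 4 * (tnorm M (ziter f (int N) x) (tziter f (int N) x w) * tnorm M x e)"
    and v: "critical_vector f c v"
  obtains J w where "0 < J" "ziter f (- int J) c \<in> nbhd \<epsilon> (noncritical_part M f A \<delta>)"
    "w \<in> F (ziter f (- int J) c)" "w \<noteq> 0"
    "tziter f (int J) (ziter f (- int J) c) w \<in> span {v}"
proof -
  have bij: "bij f" using f by (simp add: C1_diffeo_def)
  define y where "y j = ziter f (- int j) c" for j
  let ?K = "noncritical_part M f A \<delta>"
  let ?g = "\<lambda>x e w. tnorm M (ziter f (int N) x) (tziter f (int N) x e) * tnorm M x w"
  obtain J0 where J0: "\<And>j. j \<ge> J0 \<Longrightarrow> y j \<in> nbhd \<epsilon> ?K"
    "\<And>j e w. j \<ge> J0 \<Longrightarrow> e \<in> E (y j) \<Longrightarrow> w \<in> F (y j) \<Longrightarrow> ?g (y j) e w \<le> 1 / 2 * ?g (y j) w e"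
    using backward_domination[OF f A c avoid \<epsilon> split dom]
    unfolding eventually_sequentially Let_def y_def by blast
  \<comment> \<open>The successor makes \<open>J\<close> positive, which later keeps n - J strictly
    below n.\<close>
  define J where "J = Suc J0"
  define z where "z = y J"
  have yU: "y j \<in> U" if "j \<ge> J" for j using J0(1)[of j] \<epsilon>(2) that by (auto simp: J_def)
  have zU: "z \<in> U" using yU by (simp add: z_def)
  have y_shift: "ziter f (- int i) z = y (J + i)" for i
    using ziter_add_apply[OF bij, of "- int i" "- int J" c] by (simp add: y_def z_def add.commute)
  have f_y: "f (y (Suc j)) = y j" for j
    using ziter_add_1[OF bij, of "- int (Suc j)"] by (simp add: y_def fun_eq_iff)
  have image: "tmap M f (y (J + Suc i)) ` E (y (J + Suc i)) = E (y (J + i)) \<and>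
      tmap M f (y (J + Suc i)) ` F (y (J + Suc i)) = F (y (J + i))" for i
    using inv[of "y (J + Suc i)"] yU[of "J + Suc i"] yU[of "J + i"] f_y[of "J + i"] by simp
  have backE: "tziter f (- int i) z a \<in> E (y (J + i))" if "a \<in> E z" for i a
    using tziter_backward_mem[OF f, of a E z i] that image unfolding y_shift by blast
  have backF: "tziter f (- int i) z a \<in> F (y (J + i))" if "a \<in> F z" for i a
    using tziter_backward_mem[OF f, of a F z i] that image unfolding y_shift by blast
  have "subspace (E z) \<and> dim (E z) = 1" "subspace (F z) \<and> dim (F z) = 1"
    and EF: "E z \<inter> F z = {0}" using split zU by (auto simp: splitting_def)
  then obtain e w where e: "e \<in> E z" "e \<noteq> 0" and w: "w \<in> F z" "w \<noteq> 0" "F z = span {w}"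
    using dim1_obtain by metis
  have e_nspan: "e \<notin> span {w}" using e w EF by auto
  define \<Phi> where "\<Phi> = tziter f (int J) z w"
  \<comment> \<open>Otherwise \<open>\<Phi>\<close>, the image at \<open>c\<close> of the
    \<open>F\<close> direction, is an admissible test vector for
    \<open>critical_vector_bound\<close>, and \<open>v\<close> cannot outgrow it along the backward
    orbit.\<close>
  have "\<Phi> \<in> span {v}"
  proof (rule ccontr)
    assume "\<Phi> \<notin> span {v}"
    then obtain B where B: "\<And>n. tnorm M (ziter f n c) (tziter f n c v) \<le>
        B * tnorm M (ziter f n c) (tziter f n c \<Phi>)"
      using critical_vector_bound[OF v] by blast
    have zc: "ziter f (int J) z = c" using bij by (simp add: z_def y_def ziter_add_apply ziter_0_apply)
    define u where "u = tziter f (- int J) c v"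
    have u_eq: "tziter f (- int i - int J) c v = tziter f (- int i) z u" for i
      using tziter_add[OF f, of "- int i" "- int J" c v] by (simp add: u_def z_def y_def)
    have \<Phi>_eq: "tziter f (- int i - int J) c \<Phi> = tziter f (- int i) z w" for i
      using tziter_add[OF f, of "- int i - int J" "int J" z w] by (simp add: \<Phi>_def zc)
    have y_back: "ziter f (- int i - int J) c = y (J + i)" for i
    proof -
      have "- int i - int J = - int (J + i)" by simp
      then show ?thesis by (simp only: y_def)
    qed
    obtain \<beta> \<alpha> where \<alpha>: "u = \<beta> *\<^sub>R w + \<alpha> *\<^sub>R e" using spans_plane[OF w(2) e_nspan] by blast
    \<comment> \<open>A vanishing \<open>E\<close> component would make \<open>v\<close> a multiple
      of \<open>\<Phi>\<close>, against the assumption.\<close>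
    have "\<alpha> \<noteq> 0"
    proof
      assume "\<alpha> = 0"
      then have uw: "u = \<beta> *\<^sub>R w" using \<alpha> by simp
      have "v = tziter f (int J) z u"
        using tziter_add[OF f, of "int J" "- int J" c v] tziter_0[of f c v]
        by (simp add: u_def z_def y_def)
      then have v\<Phi>: "v = \<beta> *\<^sub>R \<Phi>" by (simp add: uw \<Phi>_def linear_scale[OF linear_tziter[OF f]])
      moreover have "v \<noteq> 0" using v by (simp add: critical_vector_def)
      ultimately show False
        using \<open>\<Phi> \<notin> span {v}\<close> span_singleton_scaleR[of \<beta> \<Phi>] span_base[of \<Phi> "{\<Phi>}"] by auto
    qed
    define a b where "a i = tnorm M (y (J + i)) (tziter f (- int i) z e)"
      and "b i = tnorm M (y (J + i)) (tziter f (- int i) z w)" for i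
    have pos: "a i > 0" "b i > 0" for i
      using e w by (auto simp: a_def b_def tziter_eq_0_iff[OF f] intro!: tnorm_pos)
    \<comment> \<open>Criticality bounds the iterates of \<open>u\<close> by the \<open>F\<close>
      growth \<open>b i\<close>; subtracting the \<open>F\<close> part bounds the \<open>E\<close>
      part, with a constant independent of \<open>i\<close>.\<close>
    have bound: "\<bar>\<alpha>\<bar> * a i \<le> (B + \<bar>\<beta>\<bar>) * b i" for i
    proof -
      let ?u = "tziter f (- int i) z u"
      have "\<alpha> *\<^sub>R tziter f (- int i) z e = ?u + (- \<beta>) *\<^sub>R tziter f (- int i) z w"
        by (simp add: \<alpha> linear_add[OF linear_tziter[OF f]] linear_scale[OF linear_tziter[OF f]])
      then have "\<bar>\<alpha>\<bar> * a i = tnorm M (y (J + i)) (?u + (- \<beta>) *\<^sub>R tziter f (- int i) z w)"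
        unfolding a_def by (simp flip: tnorm_scaleR)
      also have "\<dots> \<le> tnorm M (y (J + i)) ?u + \<bar>\<beta>\<bar> * b i"
        unfolding b_def using tnorm_triangle[of "y (J + i)" ?u "(- \<beta>) *\<^sub>R tziter f (- int i) z w"]
        by (simp only: tnorm_scaleR abs_minus_cancel)
      also have "tnorm M (y (J + i)) ?u \<le> B * b i"
        using B[of "- int i - int J"] by (simp only: y_back u_eq \<Phi>_eq b_def)
      finally show ?thesis by (simp add: algebra_simps)
    qed
    \<comment> \<open>Domination over \<open>N\<close> forward steps, from
      \<open>y (J + N * Suc k)\<close> to \<open>y (J + N * k)\<close>, says that the quotient b / a
      is at least halved by each block of \<open>N\<close> backward steps.\<close>
    have halve: "a (N * k) * b (N * Suc k) \<le> 1 / 2 * (b (N * k) * a (N * Suc k))" for k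
    proof -
      let ?i = "N * Suc k"
      have *: "tziter f (int N) (y (J + ?i)) (tziter f (- int ?i) z d) = tziter f (- int (N * k)) z d" for d
      proof -
        have "int N + - int ?i = - int (N * k)" by simp
        then show ?thesis
          using tziter_add[OF f, of "int N" "- int ?i" z d] by (simp only: y_shift)
      qed
      have "ziter f (int N) (y (J + ?i)) = y (J + N * k)"
        by (simp add: y_def ziter_add_apply[OF bij] algebra_simps)
      then show ?thesis
        using J0(2)[OF _ backE[OF e(1), of ?i] backF[OF w(1), of ?i]]
        by (simp only: * a_def b_def) (simp add: J_def)
    qed
    have ratio: "b (N * k) / a (N * k) \<le> b 0 / a 0 * (1 / 2) ^ k" for k
    proof (induction k)
      case (Suc k)
      have "b (N * Suc k) / a (N * Suc k) \<le> 1 / 2 * (b (N * k) / a (N * k))"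
        using halve[of k] pos(1)[of "N * k"] pos(1)[of "N * Suc k"]
        by (simp add: field_simps del: mult_Suc_right)
      also have "\<dots> \<le> 1 / 2 * (b 0 / a 0 * (1 / 2) ^ k)" using Suc by simp
      finally show ?case by simp
    qed simp
    have le: "\<bar>\<alpha>\<bar> \<le> (\<bar>B\<bar> + \<bar>\<beta>\<bar>) * (b 0 / a 0 * (1 / 2) ^ k)" for k
    proof -
      have "\<bar>\<alpha>\<bar> \<le> (B + \<bar>\<beta>\<bar>) * (b (N * k) / a (N * k))"
        using bound[of "N * k"] pos[of "N * k"] by (simp add: field_simps)
      also have "\<dots> \<le> (\<bar>B\<bar> + \<bar>\<beta>\<bar>) * (b (N * k) / a (N * k))"
        using pos[of "N * k"] by (intro mult_right_mono) auto
      also have "\<dots> \<le> (\<bar>B\<bar> + \<bar>\<beta>\<bar>) * (b 0 / a 0 * (1 / 2) ^ k)"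
        by (intro mult_left_mono ratio) auto
      finally show ?thesis .
    qed
    have "(\<lambda>k. (\<bar>B\<bar> + \<bar>\<beta>\<bar>) * (b 0 / a 0 * (1 / 2) ^ k)) \<longlonglongrightarrow> (\<bar>B\<bar> + \<bar>\<beta>\<bar>) * (b 0 / a 0 * 0)"
      by (intro tendsto_mult tendsto_const LIMSEQ_power_zero) simp
    then have "\<bar>\<alpha>\<bar> \<le> (\<bar>B\<bar> + \<bar>\<beta>\<bar>) * (b 0 / a 0 * 0)"
      by (rule LIMSEQ_le_const) (use le in blast)
    with \<open>\<alpha> \<noteq> 0\<close> show False by simp
  qed
  then show ?thesis
    using that[of J w] w J0(1)[of J] by (simp add: J_def \<Phi>_def z_def y_def)
qed

text \<open>Charts of \<open>K\<close> that miss \<open>x\<close> impose nothing, and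
  \<open>K\<close> is finite, so the bounds in the remaining charts hold simultaneously from some
  index on. A chart around \<open>x\<close> eventually contains \<open>X k\<close>, which makes the
  directions comparable.\<close>

lemma slope_less_eventually:
  assumes K: "local_coordinates M K"
    and V: "tvec_tendsto X V x v" "v \<noteq> 0" and e: "\<epsilon> > 0"
  shows "\<forall>\<^sub>F k in sequentially. slope_less M K (X k) (span {V k}) x (span {v}) \<epsilon>"
proof -
  have K': "finite K" "\<And>d. d \<in> K \<Longrightarrow> d \<in> charts M" "\<exists>d\<in>K. x \<in> cdom d"
    using K by (auto simp: local_coordinates_def)
  obtain d where d: "d \<in> K" "x \<in> cdom d" using K' by blast
  have "\<forall>\<^sub>F k in sequentially. X k \<in> cdom d"
    using eventually_in_chart[OF K'(2)[OF d(1)] d(2) tvec_tendstoD(1)[OF V(1)]] .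
  moreover have "\<forall>\<^sub>F k in sequentially. \<forall>d\<in>K. x \<in> cdom d \<longrightarrow>
      slope M d (X k) (span {V k}) x (span {v}) < \<epsilon>"
  proof (intro eventually_ball_finite K' ballI)
    fix d assume "d \<in> K"
    then show "\<forall>\<^sub>F k in sequentially. x \<in> cdom d \<longrightarrow> slope M d (X k) (span {V k}) x (span {v}) < \<epsilon>"
      using order_tendstoD(2)[OF slope_tendsto_0[OF V] e] K' by (cases "x \<in> cdom d") auto
  qed
  ultimately show ?thesis
    by eventually_elim (use d in \<open>auto simp: slope_less_def\<close>)
qed

text \<open>The domination enters only through the inequality for one iterate, and the line fields
  are arbitrary, so the same statement can be applied to the inverse with the two fields
  exchanged.\<close>

lemma forward_critical_approach:
  assumes K: "local_coordinates M K" and f: "C1_diffeo M f"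
    and A: "compact A" "f ` A = A"
    and \<epsilon>: "\<epsilon> > 0" "nbhd \<epsilon> (noncritical_part M f A \<delta>) \<subseteq> U"
    and U: "open U" and split: "splitting M U E F"
    and inv: "\<And>x. x \<in> U \<Longrightarrow> f x \<in> U \<Longrightarrow> tmap M f x ` E x = E (f x) \<and> tmap M f x ` F x = F (f x)"
    and dom: "\<And>x e w. x \<in> noncritical_part M f A \<delta> \<Longrightarrow> e \<in> E x \<Longrightarrow> w \<in> F x \<Longrightarrow>
      tnorm M (ziter f (int N) x) (tziter f (int N) x e) * tnorm M x w \<le>
      1 / 4 * (tnorm M (ziter f (int N) x) (tziter f (int N) x w) * tnorm M x e)"
  shows "\<exists>N\<^sub>0 > 0. \<exists>\<delta>\<^sub>2 > 0. \<forall>x\<in>A. \<forall>n\<ge>N\<^sub>0.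
    (\<forall>j<n. ziter f (int j) x \<notin> nbhd \<delta> (Crit M f A)) \<longrightarrow>
    ziter f (int n) x \<in> nbhd \<delta>\<^sub>2 (Crit M f A) \<longrightarrow>
    (\<exists>m. 0 < m \<and> m < n \<and> ziter f (int m) x \<in> nbhd \<epsilon> (noncritical_part M f A \<delta>) \<and>
      (\<exists>c\<in>Crit M f A. \<exists>v. critical_direction M f c v \<and>
        slope_less M K (ziter f (int n) x)
          (Gpow_line M f (int n - int m) (ziter f (int m) x) (F (ziter f (int m) x)))
          c (span {v}) \<epsilon>))"
    (is "\<exists>N\<^sub>0 > 0. \<exists>\<delta>\<^sub>2 > 0. \<forall>x\<in>A. \<forall>n\<ge>N\<^sub>0. ?avoid x n \<longrightarrow> ?near \<delta>\<^sub>2 x n \<longrightarrow> ?good x n")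
proof (rule ccontr)
  let ?C = "Crit M f A"
  let ?K = "noncritical_part M f A \<delta>"
  assume contra: "\<not> ?thesis"
  have bij: "bij f" using f by (simp add: C1_diffeo_def)
  \<comment> \<open>Failure for the threshold k + 1 and the radius 1 / (k + 1) supplies one
    violating segment for each \<open>k\<close>: lengths tend to infinity and endpoints approach
    \<open>Crit\<close>.\<close>
  have "\<exists>x\<in>A. \<exists>n\<ge>Suc k. ?avoid x n \<and> ?near (inverse (real (Suc k))) x n \<and> \<not> ?good x n" for k
  proof -
    have "\<not> (\<forall>x\<in>A. \<forall>n\<ge>Suc k. ?avoid x n \<longrightarrow> ?near (inverse (real (Suc k))) x n \<longrightarrow> ?good x n)"
    proof
      assume "\<forall>x\<in>A. \<forall>n\<ge>Suc k. ?avoid x n \<longrightarrow> ?near (inverse (real (Suc k))) x n \<longrightarrow> ?good x n"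
      then have "\<exists>N\<^sub>0 > 0. \<exists>\<delta>\<^sub>2 > 0. \<forall>x\<in>A. \<forall>n\<ge>N\<^sub>0. ?avoid x n \<longrightarrow> ?near \<delta>\<^sub>2 x n \<longrightarrow> ?good x n"
        by (intro exI[of _ "Suc k"] exI[of _ "inverse (real (Suc k))"] conjI) simp_all
      with contra show False by (rule notE)
    qed
    then show ?thesis by blast
  qed
  then obtain x n where x: "\<And>k. x k \<in> A" and n: "\<And>k. n k \<ge> Suc k"
    and xn: "\<And>k. ?avoid (x k) (n k)" "\<And>k. ?near (inverse (real (Suc k))) (x k) (n k)"
    and bad: "\<And>k. \<not> ?good (x k) (n k)"
    by metis
  have avoid: "\<And>k j. j < n k \<Longrightarrow> ziter f (int j) (x k) \<notin> nbhd \<delta> ?C"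
    and near: "\<And>k. ziter f (int (n k)) (x k) \<in> nbhd (inverse (real (Suc k))) ?C"
    using xn by blast+
  define p where "p k = ziter f (int (n k)) (x k)" for k
  have "\<exists>c v. c \<in> A \<and> critical_vector f c v \<and> dist c (p k) < inverse (real (Suc k))" for k
    using near[of k] by (auto simp: nbhd_def p_def Crit_iff[OF f])
  then obtain c v where cA: "\<And>k. c k \<in> A" and cv: "\<And>k. critical_vector f (c k) (v k)"
    and dist: "\<And>k. dist (c k) (p k) < inverse (real (Suc k))"
    by metis
  obtain c0 s where s: "c0 \<in> A" "strict_mono s" "(c \<circ> s) \<longlonglongrightarrow> c0"
    using A(1) cA unfolding compact_eq_seq_compact_metric seq_compact_def by metis
  have "v k \<noteq> 0" for k using cv by (simp add: critical_vector_def)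
  \<comment> \<open>The further subsequence \<open>t\<close> serves only to find the limit direction
    \<open>v0\<close>. The base points already converge along \<open>s\<close>, which is the one
    used afterwards.\<close>
  then obtain t a v0 where t: "strict_mono t" "\<And>k. a k \<noteq> 0" "v0 \<noteq> 0"
    "tvec_tendsto ((c \<circ> s) \<circ> t) (\<lambda>k. a k *\<^sub>R v (s (t k))) c0 v0"
    using nonzero_direction_subseq[OF s(3), of "\<lambda>k. v (s k)"] by blast
  have v0: "critical_vector f c0 v0"
    by (rule critical_vector_limit[OF f t(4,3)]) (use critical_vector_scaleR[OF f cv t(2)] in simp)
  have c0: "c0 \<in> ?C" using s(1) v0 by (auto simp: Crit_iff[OF f])
  have ps: "(\<lambda>k. p (s k)) \<longlonglongrightarrow> c0"
  proof (rule metric_LIMSEQ_I)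
    fix e :: real assume e: "e > 0"
    have "(\<lambda>k. c (s k)) \<longlonglongrightarrow> c0" using s(3) by (simp add: comp_def)
    then have "\<forall>\<^sub>F k in sequentially. dist (c (s k)) c0 < e / 2" using e tendstoD half_gt_zero by blast
    moreover have "\<forall>\<^sub>F k in sequentially. inverse (real (Suc k)) < e / 2"
      using order_tendstoD(2)[OF LIMSEQ_inverse_real_of_nat, of "e / 2"] e by simp
    ultimately have "\<forall>\<^sub>F k in sequentially. dist (p (s k)) c0 < e"
    proof eventually_elim
      case (elim k)
      have "inverse (real (Suc (s k))) \<le> inverse (real (Suc k))"
        using seq_suble[OF s(2), of k] by (simp add: le_imp_inverse_le)
      then show ?case
        using dist[of "s k"] elim dist_triangle3[of "p (s k)" c0 "c (s k)"] by linarith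
    qed
    then show "\<exists>N. \<forall>k\<ge>N. dist (p (s k)) c0 < e" by (simp add: eventually_sequentially)
  qed
  \<comment> \<open>The point \<open>j\<close> steps before the end of a segment of length n is at
    time n - j, which lies in the avoided range 0, ..., n - 1 when 0 < j \<le> n. As lengths tend to
    infinity, every fixed \<open>j\<close> is eventually covered.\<close>
  have c0_avoid: "ziter f (- int j) c0 \<notin> nbhd \<delta> ?C" if j: "0 < j" for j
  proof -
    have "\<forall>\<^sub>F k in sequentially. ziter f (- int j) (p (s k)) \<in> - nbhd \<delta> ?C"
      using eventually_ge_at_top[of j]
    proof eventually_elim
      case (elim k)
      then have "j \<le> n (s k)" using seq_suble[OF s(2), of k] n[of "s k"] by linarith
      then have "ziter f (- int j) (p (s k)) = ziter f (int (n (s k) - j)) (x (s k))"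
        by (simp add: p_def ziter_add_apply[OF bij] of_nat_diff)
      then show ?case using avoid[of "n (s k) - j" "s k"] j \<open>j \<le> n (s k)\<close> by simp
    qed
    then have "ziter f (- int j) c0 \<in> - nbhd \<delta> ?C"
      by (intro Lim_in_closed_set[OF _ _ _ isCont_tendsto_compose[OF
            isCont_C1_map[OF C1_map_ziter[OF f]] ps]]) (simp_all add: closed_Compl open_nbhd)
    then show ?thesis by simp
  qed
  \<comment> \<open>\<open>J\<close> depends on \<open>c0\<close> alone and not on the segment, so
    only the one map f^J and its continuous derivative remain to be controlled.\<close>
  obtain J w where J: "0 < J" "ziter f (- int J) c0 \<in> nbhd \<epsilon> ?K"
    and w: "w \<in> F (ziter f (- int J) c0)" "w \<noteq> 0"
    and \<Phi>: "tziter f (int J) (ziter f (- int J) c0) w \<in> span {v0}"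
    using critical_vector_in_F[OF f A s(1) c0_avoid \<epsilon> split inv dom v0] by blast
  define z where "z = ziter f (- int J) c0"
  have zs: "(\<lambda>k. ziter f (- int J) (p (s k))) \<longlonglongrightarrow> z"
    unfolding z_def by (rule isCont_tendsto_compose[OF isCont_C1_map[OF C1_map_ziter[OF f]] ps])
  have "\<forall>\<^sub>F k in sequentially. ziter f (- int J) (p (s k)) \<in> nbhd \<epsilon> ?K \<and> J \<le> k"
    using topological_tendstoD[OF zs open_nbhd] J(2) eventually_ge_at_top[of J]
    by (auto simp: z_def intro: eventually_conj)
  then obtain k0 where k0: "\<And>k. k \<ge> k0 \<Longrightarrow> ziter f (- int J) (p (s k)) \<in> nbhd \<epsilon> ?K"
      "\<And>k. k \<ge> k0 \<Longrightarrow> J \<le> k"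
    by (auto simp: eventually_sequentially)
  define r where "r k = s (k + k0)" for k
  define X where "X k = ziter f (- int J) (p (r k))" for k
  have X: "X \<longlonglongrightarrow> z" unfolding X_def r_def by (rule LIMSEQ_ignore_initial_segment[OF zs])
  have XU: "X k \<in> U" "X k \<in> nbhd \<epsilon> ?K" for k using k0(1)[of "k + k0"] \<epsilon>(2) by (auto simp: X_def r_def)
  have zU: "z \<in> U" using J(2) \<epsilon>(2) by (auto simp: z_def)
  have lineF: "y \<in> U \<Longrightarrow> subspace (F y) \<and> dim (F y) = 1" for y using split by (auto simp: splitting_def)
  have clF: "continuous_lines M U F" using split by (simp add: splitting_def)
  obtain W where W: "\<And>k. W k \<in> F (X k)" "tvec_tendsto X W z w"
    using continuous_lines_lift[OF clF lineF X XU(1) zU w[folded z_def]] by blast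
  have Jn: "J < n (r k)" for k
    using k0(2)[of "k + k0"] seq_suble[OF s(2), of "k + k0"] n[of "r k"] by (simp add: r_def)
  have pX: "ziter f (int J) (X k) = p (r k)" for k by (simp add: X_def ziter_add_apply[OF bij] ziter_0_apply)
  have zc: "ziter f (int J) z = c0" by (simp add: z_def ziter_add_apply[OF bij] ziter_0_apply)
  let ?W = "\<lambda>k. tziter f (int J) (X k) (W k)"
  let ?w = "tziter f (int J) z w"
  have lim: "tvec_tendsto (\<lambda>k. p (r k)) ?W c0 ?w"
    using tvec_tendsto_tmap[OF C1_map_ziter[OF f, of "int J"] W(2)] by (simp add: pX zc)
  have w0: "?w \<noteq> 0" using w by (simp add: tziter_eq_0_iff[OF f])
  have "\<forall>\<^sub>F k in sequentially. 0 < tnorm M (X k) (W k)"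
    by (rule order_tendstoD(1)[OF tnorm_tendsto[OF W(2)] tnorm_pos[OF w(2)]])
  then have "\<forall>\<^sub>F k in sequentially. 0 < tnorm M (X k) (W k) \<and>
      slope_less M K (p (r k)) (span {?W k}) c0 (span {?w}) \<epsilon>"
    using slope_less_eventually[OF K lim w0 \<epsilon>(1)] by (rule eventually_conj)
  then obtain k where k: "0 < tnorm M (X k) (W k)"
      "slope_less M K (p (r k)) (span {?W k}) c0 (span {?w}) \<epsilon>"
    by (auto simp: eventually_sequentially)
  \<comment> \<open>Going back \<open>J\<close> steps from the end makes n - m the fixed number
    \<open>J\<close>; positivity of \<open>m\<close> is \<open>Jn\<close>.\<close>
  define m where "m = n (r k) - J"
  have m: "0 < m" "m < n (r k)" "int (n (r k)) - int m = int J" using Jn[of k] J(1) by (auto simp: m_def)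
  have Xm: "ziter f (int m) (x (r k)) = X k"
    using Jn[of k] by (simp add: X_def p_def ziter_add_apply[OF bij] m_def of_nat_diff)
  have Wk: "W k \<noteq> 0" using k(1) tnorm_eq_0_iff[of "X k" "W k"] by auto
  have FX: "F (X k) = span {W k}" using dim1_span lineF[OF XU(1)] W(1) Wk by blast
  obtain b where b: "?w = b *\<^sub>R v0" using \<Phi> by (auto simp: span_singleton z_def)
  \<comment> \<open>The limit of the image lines is the line of \<open>v0\<close>, rewritten with a
    unit vector because \<open>critical_direction\<close> requires norm 1.\<close>
  have "span {?w} = span {v0}" using w0 b span_singleton_scaleR[of b v0] by auto
  also have "\<dots> = span {tunit c0 v0}"
    using span_singleton_scaleR[of "1 / tnorm M c0 v0" v0] tnorm_pos[OF t(3), of c0]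
    by (simp add: tunit_def)
  finally have "slope_less M K (ziter f (int (n (r k))) (x (r k)))
      (Gpow_line M f (int (n (r k)) - int m) (ziter f (int m) (x (r k))) (F (ziter f (int m) (x (r k)))))
      c0 (span {tunit c0 v0}) \<epsilon>"
    using m k(2) by (simp add: Xm FX Gpow_line_span[OF f Wk] flip: p_def)
  moreover have "ziter f (int m) (x (r k)) \<in> nbhd \<epsilon> ?K" using XU(2) by (simp add: Xm)
  ultimately have "?good (x (r k)) (n (r k))"
    using m(1,2) c0 critical_direction_tunit[OF f v0] by blast
  with bad show False by blast
qed

section \<open>Domination for one iterate and reversal of time\<close>

lemma tnorm_zero: "tnorm M x 0 = 0"
  by (simp add: tnorm_eq_0_iff)

text \<open>The supremum runs over the two opposite unit vectors of the line, whose images have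
  equal norm.\<close>

lemma norm_restrict_span:
  assumes g: "C1_map M g" and v: "v \<noteq> 0"
  shows "norm_restrict M g x (span {v}) = tnorm M (g x) (tmap M g x v) / tnorm M x v"
proof -
  have "{tnorm M (g x) (tmap M g x u) |u. u \<in> span {v} \<and> tnorm M x u = 1} =
      (\<lambda>u. tnorm M (g x) (tmap M g x u)) ` {u \<in> span {v}. tnorm M x u = 1}"
    by blast
  also have "\<dots> = {tnorm M (g x) (tmap M g x v) / tnorm M x v}"
    using tnorm_pos[OF v, of x] tnorm_scaleR[of "g x" "-1"] unfolding unit_vectors_span[OF v]
    by (simp add: tunit_def linear_scale[OF linear_tmap[OF g]] linear_neg[OF linear_tmap[OF g]]
        tnorm_scaleR)
  finally show ?thesis by (simp add: norm_restrict_def)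
qed

text \<open>\<open>N\<close> is taken so large that C q^N < 1/4. Multiplying out the quotients makes
  the inequality valid for zero vectors too and ready for passage to limits.\<close>

lemma dominated_splitting_step:
  assumes f: "C1_diffeo M f" and dom: "dominated_splitting M f S E F"
  obtains N where "\<And>x e w. x \<in> S \<Longrightarrow> e \<in> E x \<Longrightarrow> w \<in> F x \<Longrightarrow>
    tnorm M (ziter f (int N) x) (tziter f (int N) x e) * tnorm M x w \<le>
    1 / 4 * (tnorm M (ziter f (int N) x) (tziter f (int N) x w) * tnorm M x e)"
proof -
  obtain C q where C: "C > 0" "0 < q" "q < 1" and
    le: "\<And>x n. x \<in> S \<Longrightarrow>
      norm_restrict M (f ^^ n) x (E x) \<le> C * q ^ n * norm_restrict M (f ^^ n) x (F x)"
    using dom unfolding dominated_splitting_def by blast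
  have "(\<lambda>n. C * q ^ n) \<longlonglongrightarrow> C * 0"
    using C by (intro tendsto_mult tendsto_const LIMSEQ_power_zero) simp
  then have "\<forall>\<^sub>F n in sequentially. C * q ^ n < 1 / 4"
    by (rule order_tendstoD) simp
  then obtain N where N: "C * q ^ N < 1 / 4" by (auto simp: eventually_sequentially)
  show ?thesis
  proof (rule that[of N])
    fix x e w assume x: "x \<in> S" and e: "e \<in> E x" and w: "w \<in> F x"
    let ?n = "\<lambda>u. tnorm M (ziter f (int N) x) (tziter f (int N) x u)"
    show "?n e * tnorm M x w \<le> 1 / 4 * (?n w * tnorm M x e)"
    proof (cases "e = 0 \<or> w = 0")
      case True
      then show ?thesis
        by (auto simp: tnorm_zero linear_0[OF linear_tziter[OF f]])
    next
      case False
      have "E x = span {e}" "F x = span {w}"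
        using dim1_span x e w False dom by (auto simp: dominated_splitting_def splitting_def)
      then have "?n e / tnorm M x e \<le> C * q ^ N * (?n w / tnorm M x w)"
        using le[OF x, of N] False norm_restrict_span[OF C1_map_ziter[OF f]]
        unfolding ziter_of_nat[symmetric] by simp
      also have "\<dots> \<le> 1 / 4 * (?n w / tnorm M x w)"
        using N tnorm_nonneg by (intro mult_right_mono) simp_all
      finally show ?thesis
        using tnorm_pos[of e x] tnorm_pos[of w x] False by (simp add: field_simps)
    qed
  qed
qed

end

lemma nbhd_mono: "r \<le> s \<Longrightarrow> nbhd r A \<subseteq> nbhd s A"
  by (auto simp: nbhd_def)

lemma splitting_swap: "splitting M U E F \<Longrightarrow> splitting M U F E"
proof -
  have "{u + w |u w. u \<in> B \<and> w \<in> A} = {u + w |u w. u \<in> A \<and> w \<in> B}" for A B :: "(real^2) set"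
    using add.commute by blast
  then show "splitting M U E F \<Longrightarrow> splitting M U F E"
    by (auto simp: splitting_def Int_commute)
qed

theorem corollary11:
  fixes M :: "'a::metric_space surface"
    and f :: "'a \<Rightarrow> 'a"
    and \<Lambda> U :: "'a set"
    and K :: "'a chart set"
    and E F E' F' :: "'a \<Rightarrow> (real^2) set"
    and \<delta>\<^sub>0 \<delta>\<^sub>1 \<epsilon> :: real
  assumes "riemannian_surface M"
    and "compact (UNIV :: 'a set)"
    and "local_coordinates M K"
    and "C1_diffeo M f"
    and "compact \<Lambda>"
    and "f ` \<Lambda> = \<Lambda>"
    and "\<delta>\<^sub>0 > 0"
    and "noncritical_part M f \<Lambda> \<delta>\<^sub>0 \<noteq> {}"
    and "0 < \<delta>\<^sub>1"
    and "\<delta>\<^sub>1 < \<delta>\<^sub>0"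
    and "dominated_splitting M f (noncritical_part M f \<Lambda> \<delta>\<^sub>1) E F"
    and "extends_splitting M f (noncritical_part M f \<Lambda> \<delta>\<^sub>1) E F U E' F'"
    and "\<epsilon> > 0"
    and "nbhd \<epsilon> (noncritical_part M f \<Lambda> \<delta>\<^sub>1) \<subseteq> U"
  shows "\<exists>N\<^sub>0 :: nat. \<exists>\<delta>\<^sub>2 :: real. N\<^sub>0 > 0 \<and> \<delta>\<^sub>2 > 0 \<and>
    (\<forall>x\<in>\<Lambda>.
      (\<forall>n\<ge>N\<^sub>0.
        (\<forall>j<n. ziter f (int j) x \<notin> nbhd \<delta>\<^sub>1 (Crit M f \<Lambda>)) \<longrightarrow>
        ziter f (int n) x \<in> nbhd \<delta>\<^sub>2 (Crit M f \<Lambda>) \<longrightarrow>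
        (\<exists>m. 0 < m \<and> m < n \<and>
          ziter f (int m) x \<in> nbhd \<epsilon> (noncritical_part M f \<Lambda> \<delta>\<^sub>1) \<and>
          (\<exists>c\<in>Crit M f \<Lambda>. \<exists>v. critical_direction M f c v \<and>
            slope_less M K
              (ziter f (int n) x)
              (Gpow_line M f (int n - int m) (ziter f (int m) x) (F' (ziter f (int m) x)))
              c (span {v}) \<epsilon>))) \<and>
      (\<forall>n\<ge>N\<^sub>0.
        (\<forall>j<n. ziter f (- int j) x \<notin> nbhd \<delta>\<^sub>1 (Crit M f \<Lambda>)) \<longrightarrow>
        ziter f (- int n) x \<in> nbhd \<delta>\<^sub>2 (Crit M f \<Lambda>) \<longrightarrow>
        (\<exists>m. 0 < m \<and> m < n \<and>
          ziter f (- int m) x \<in> nbhd \<epsilon> (noncritical_part M f \<Lambda> \<delta>\<^sub>1) \<and>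
          (\<exists>c\<in>Crit M f \<Lambda>. \<exists>v. critical_direction M f c v \<and>
            slope_less M K
              (ziter f (- int n) x)
              (Gpow_line M f (- (int n - int m)) (ziter f (- int m) x) (E' (ziter f (- int m) x)))
              c (span {v}) \<epsilon>))))"
proof -
  interpret riemannian_surface M by (rule assms(1))
  let ?S = "noncritical_part M f \<Lambda> \<delta>\<^sub>1"
  note f = \<open>C1_diffeo M f\<close>
  note g = C1_diffeo_inv[OF f]
  have bij: "bij f" using f by (simp add: C1_diffeo_def)
  have U: "open U" "?S \<subseteq> U" "splitting M U E' F'" "\<And>x. x \<in> ?S \<Longrightarrow> E' x = E x \<and> F' x = F x"
    and inv: "\<And>x. x \<in> U \<Longrightarrow> f x \<in> U \<Longrightarrow> tmap M f x ` E' x = E' (f x) \<and> tmap M f x ` F' x = F' (f x)"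
    using assms(12) by (auto simp: extends_splitting_def)
  obtain N where dom: "\<And>x e w. x \<in> ?S \<Longrightarrow> e \<in> E' x \<Longrightarrow> w \<in> F' x \<Longrightarrow>
      tnorm M (ziter f (int N) x) (tziter f (int N) x e) * tnorm M x w \<le>
      1 / 4 * (tnorm M (ziter f (int N) x) (tziter f (int N) x w) * tnorm M x e)"
    using dominated_splitting_step[OF f assms(11)] U(4) by metis
  have backward: "tziter f (- int i) x a \<in> L (ziter f (- int i) x)"
    if x: "x \<in> ?S" and a: "a \<in> L x" and L: "\<And>x. x \<in> ?S \<Longrightarrow> tmap M f x ` L x = L (f x)"
    for i x a and L :: "'a \<Rightarrow> (real^2) set"
  proof (rule tziter_backward_mem[OF f, of _ L, OF a])
    fix i
    have "f (ziter f (- int (Suc i)) x) = ziter f (- int i) x"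
      using ziter_add_1[OF bij, of "- int (Suc i)"] by (simp add: fun_eq_iff)
    then show "tmap M f (ziter f (- int (Suc i)) x) ` L (ziter f (- int (Suc i)) x) =
        L (ziter f (- int i) x)"
      using L[OF noncritical_part_ziter[OF bij x, of "- int (Suc i)"]] by simp
  qed
  \<comment> \<open>The noncritical part is mapped into itself and lies in \<open>U\<close>, so
    invariance of the extended fields applies at each of its points.\<close>
  have inv_S: "tmap M f x ` E' x = E' (f x)" "tmap M f x ` F' x = F' (f x)" if "x \<in> ?S" for x
    using inv[of x] U(2) that noncritical_part_ziter[OF bij that, of 1] ziter_of_nat[of f 1] by auto
  have backE: "tziter f (- int i) x a \<in> E' (ziter f (- int i) x)" if "x \<in> ?S" "a \<in> E' x" for i x a
    by (rule backward[of _ _ E', OF that inv_S(1)])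
  have backF: "tziter f (- int i) x a \<in> F' (ziter f (- int i) x)" if "x \<in> ?S" "a \<in> F' x" for i x a
    by (rule backward[of _ _ F', OF that inv_S(2)])
  \<comment> \<open>The inequality at f^-N(x) for the pulled-back vectors is the domination for the
    inverse, with the same \<open>N\<close> and with the roles of \<open>E'\<close> and
    \<open>F'\<close> exchanged.\<close>
  have dom': "tnorm M (ziter (inv f) (int N) x) (tziter (inv f) (int N) x w) * tnorm M x e \<le>
      1 / 4 * (tnorm M (ziter (inv f) (int N) x) (tziter (inv f) (int N) x e) * tnorm M x w)"
    if x: "x \<in> ?S" and w: "w \<in> F' x" and e: "e \<in> E' x" for x e w
  proof -
    let ?y = "ziter f (- int N) x"
    have "ziter f (int N) ?y = x" by (simp add: ziter_add_apply[OF bij] ziter_0_apply)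
    moreover have "tziter f (int N) ?y (tziter f (- int N) x a) = a" for a
      using tziter_add[OF f, of "int N" "- int N" x a] tziter_0[of f x a] by simp
    ultimately show ?thesis
      using dom[OF noncritical_part_ziter[OF bij x] backE[OF x e, of N] backF[OF x w, of N]]
      by (simp add: ziter_inv[OF bij] mult.commute)
  qed
  have inv': "tmap M (inv f) x ` F' x = F' (inv f x) \<and> tmap M (inv f) x ` E' x = E' (inv f x)"
    if "x \<in> U" "inv f x \<in> U" for x
  proof -
    have x: "f (inv f x) = x" using bij by (simp add: bij_is_surj surj_f_inv_f)
    have "tmap M (inv f) x (tmap M f (inv f x) a) = a" for a
      using tmap_inv_tmap[OF f, of "inv f x" a] by (simp add: x)
    moreover have "E' x = tmap M f (inv f x) ` E' (inv f x)" "F' x = tmap M f (inv f x) ` F' (inv f x)"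
      using inv[of "inv f x"] that by (simp_all add: x)
    ultimately show ?thesis by (simp add: image_image)
  qed
  have inv_image: "inv f ` \<Lambda> = \<Lambda>"
    using \<open>f ` \<Lambda> = \<Lambda>\<close> bij by (metis bij_is_inj image_inv_f_f)
  have "\<exists>N>0. \<exists>d>0. \<forall>x\<in>\<Lambda>. \<forall>n\<ge>N.
      (\<forall>j<n. ziter f (int j) x \<notin> nbhd \<delta>\<^sub>1 (Crit M f \<Lambda>)) \<longrightarrow>
      ziter f (int n) x \<in> nbhd d (Crit M f \<Lambda>) \<longrightarrow>
      (\<exists>m. 0 < m \<and> m < n \<and> ziter f (int m) x \<in> nbhd \<epsilon> ?S \<and>
        (\<exists>c\<in>Crit M f \<Lambda>. \<exists>v. critical_direction M f c v \<and>
          slope_less M K (ziter f (int n) x)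
            (Gpow_line M f (int n - int m) (ziter f (int m) x) (F' (ziter f (int m) x)))
            c (span {v}) \<epsilon>))"
    by (rule forward_critical_approach[OF assms(3) f assms(5,6,13,14) U(1,3)])
      (use inv dom in blast)+
  then obtain N1 d1 where fwd: "N1 > 0" "d1 > 0"
    "\<forall>x\<in>\<Lambda>. \<forall>n\<ge>N1.
      (\<forall>j<n. ziter f (int j) x \<notin> nbhd \<delta>\<^sub>1 (Crit M f \<Lambda>)) \<longrightarrow>
      ziter f (int n) x \<in> nbhd d1 (Crit M f \<Lambda>) \<longrightarrow>
      (\<exists>m. 0 < m \<and> m < n \<and> ziter f (int m) x \<in> nbhd \<epsilon> ?S \<and>
        (\<exists>c\<in>Crit M f \<Lambda>. \<exists>v. critical_direction M f c v \<and>
          slope_less M K (ziter f (int n) x)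
            (Gpow_line M f (int n - int m) (ziter f (int m) x) (F' (ziter f (int m) x)))
            c (span {v}) \<epsilon>))"
    by blast
  have "\<exists>N>0. \<exists>d>0. \<forall>x\<in>\<Lambda>. \<forall>n\<ge>N.
      (\<forall>j<n. ziter f (- int j) x \<notin> nbhd \<delta>\<^sub>1 (Crit M f \<Lambda>)) \<longrightarrow>
      ziter f (- int n) x \<in> nbhd d (Crit M f \<Lambda>) \<longrightarrow>
      (\<exists>m. 0 < m \<and> m < n \<and> ziter f (- int m) x \<in> nbhd \<epsilon> ?S \<and>
        (\<exists>c\<in>Crit M f \<Lambda>. \<exists>v. critical_direction M f c v \<and>
          slope_less M K (ziter f (- int n) x)
            (Gpow_line M f (- (int n - int m)) (ziter f (- int m) x) (E' (ziter f (- int m) x)))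
            c (span {v}) \<epsilon>))"
    \<comment> \<open>All notions for the inverse reduce to those for \<open>f\<close>: critical
      directions and the noncritical part are the same, while iterates and \<open>Gpow_line\<close>
      change the sign of the time.\<close>
    by (rule forward_critical_approach[OF assms(3) g assms(5) inv_image assms(13) _ U(1)
        splitting_swap[OF U(3)], where \<delta> = "\<delta>\<^sub>1" and N = N,
        unfolded noncritical_part_inv[OF f] Crit_inv[OF f] critical_direction_inv[OF f]
          Gpow_line_inv[OF f] ziter_inv[OF bij]])
      (use assms(14) inv' dom'[unfolded ziter_inv[OF bij]] in blast)+
  then obtain N2 d2 where bwd: "N2 > 0" "d2 > 0"
    "\<forall>x\<in>\<Lambda>. \<forall>n\<ge>N2.
      (\<forall>j<n. ziter f (- int j) x \<notin> nbhd \<delta>\<^sub>1 (Crit M f \<Lambda>)) \<longrightarrow>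
      ziter f (- int n) x \<in> nbhd d2 (Crit M f \<Lambda>) \<longrightarrow>
      (\<exists>m. 0 < m \<and> m < n \<and> ziter f (- int m) x \<in> nbhd \<epsilon> ?S \<and>
        (\<exists>c\<in>Crit M f \<Lambda>. \<exists>v. critical_direction M f c v \<and>
          slope_less M K (ziter f (- int n) x)
            (Gpow_line M f (- (int n - int m)) (ziter f (- int m) x) (E' (ziter f (- int m) x)))
            c (span {v}) \<epsilon>))"
    by blast
  have mono: "nbhd (min d1 d2) A \<subseteq> nbhd d1 A" "nbhd (min d1 d2) A \<subseteq> nbhd d2 A" for A :: "'a set"
    by (simp_all add: nbhd_mono)
  show ?thesis
  \<comment> \<open>A larger threshold and a smaller radius only strengthen the hypotheses on the
    segment, so both claims hold with common values.\<close>
  proof (rule exI[of _ "max N1 N2"], rule exI[of _ "min d1 d2"],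
      intro conjI ballI allI impI, goal_cases)
    case (3 x n)
    then show ?case
      using mono(1) by (intro fwd(3)[rule_format]) auto
  next
    case (4 x n)
    then show ?case
      using mono(2) by (intro bwd(3)[rule_format]) auto
  qed (use fwd(1,2) bwd(1,2) in auto)
qed

end
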